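(* Let $K$ be any semitopological semihypergroup. Then $AP(K)$ is left introverted and right introverted; that is, for each $\mu\in AP(K)^*$ and $f\in AP(K)$, both $T_\mu f\in AP(K)$ and $U_\mu f\in AP(K)$.
   Context: All topologies are Hausdorff. For a locally compact Hausdorff space $X$: $M(X)$ is the space of regular complex Borel measures on $X$; $M^+(X)$ is the set of finite non-negative regular Borel measures, with the cone topology (the weakest topology making $\mu\mapsto\int_X f\,d\mu$ continuous for every $f\in C_c^+(X)\cup\{1_X\}$, where $C_c^+(X)$ is the set of non-negative compactly supported continuous functions and $1_X$ is the constant function $1$); $\mathfrak{C}(X)$ is the set of compact subsets of $X$ with the Michael topology, generated by the sub-basis of sets $\{C\in\mathfrak{C}(X): C\cap U\neq\emptyset,\ C\subset V\}$ for $U,V$ open in $X$; $p_x$ is the point mass at $x$. A semitopological semihypergroup is a pair $(K,* )$ such that: (A1) $K$ is a locally compact Hausdorff space and $*$ is a binary operation making $M(K)$ an associative algebra; (A2) $*$ sends $M^+(K)\times M^+(K)$ into $M^+(K)$ and for each $\omega\in M^+(K)$ both maps $\mu\mapsto\omega*\mu$ and $\mu\mapsto\mu*\omega$ from $M^+(K)$ to $M^+(K)$ are continuous; (A3) for all $x,y\in K$, $p_x*p_y$ is a probability measure with compact support; (A4) the map $(x,y)\mapsto \mathrm{supp}(p_x*p_y)$, $K\times K\to\mathfrak{C}(K)$, is continuous. $C(K)$ is the space of bounded continuous complex-valued functions on $K$ with the supremum norm, and $B(K)$ is the space of bounded functions on $K$. For measurable $f$ on $K$ and $x,y\in K$, $L_xf(y)=R_yf(x)=f(x*y):=\int_K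 f\,d(p_x*p_y)$. $AP_r(K)$ (resp. $AP_l(K)$) is the set of $f\in C(K)$ such that $\{R_xf:x\in K\}$ (resp. $\{L_xf:x\in K\}$) is relatively compact in $C(K)$ in the norm topology; $AP(K)$ denotes the common space $AP_l(K)=AP_r(K)$. It is translation-invariant: $L_xf,R_xf\in AP(K)$ for $f\in AP(K)$, $x\in K$. For $\mu\in AP(K)^*$ the introversion operators $T_\mu,U_\mu:AP(K)\to B(K)$ are defined by $T_\mu f(x):=\mu(L_xf)$ and $U_\mu f(x):=\mu(R_xf)$ for $x\in K$. *)

theory Defs
  imports "HOL-Probability.Probability"
begin

section \<open>Regular complex Borel measures\<close>

text \<open>
  The space \<open>K\<close> is the universe of a type of class \<^class>\<open>t2_space\<close>. A complex Borel measure is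
  a set function on the Borel sets. It is required to vanish on all other sets, so that two
  measures are equal as functions iff they agree on the Borel sets.
\<close>

definition complex_borel_measure :: "('a::topological_space set \<Rightarrow> complex) \<Rightarrow> bool" where
  "complex_borel_measure \<mu> \<longleftrightarrow>
     (\<forall>E. E \<notin> sets borel \<longrightarrow> \<mu> E = 0) \<and>
     (\<forall>A :: nat \<Rightarrow> 'a set. range A \<subseteq> sets borel \<longrightarrow> disjoint_family A \<longrightarrow>
        (\<lambda>i. \<mu> (A i)) sums \<mu> (\<Union>i. A i))"

definition total_variation :: "('a::topological_space set \<Rightarrow> complex) \<Rightarrow> 'a set \<Rightarrow> ennreal" where
  "total_variation \<mu> E =
     (SUP A \<in> {A :: nat \<Rightarrow> 'a set. range A \<subseteq> sets borel \<and> disjoint_family A \<and> (\<Union>i. A i) = E}.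
        \<Sum>i. ennreal (cmod (\<mu> (A i))))"

definition regular_borel_measure :: "('a::topological_space set \<Rightarrow> complex) \<Rightarrow> bool" where
  "regular_borel_measure \<mu> \<longleftrightarrow>
     (\<forall>E \<in> sets borel.
        total_variation \<mu> E = (INF U \<in> {U. open U \<and> E \<subseteq> U}. total_variation \<mu> U) \<and>
        total_variation \<mu> E = (SUP C \<in> {C. compact C \<and> C \<subseteq> E}. total_variation \<mu> C))"

definition regular_measures :: "('a::t2_space set \<Rightarrow> complex) set" where
  "regular_measures = {\<mu>. complex_borel_measure \<mu> \<and> regular_borel_measure \<mu>}"

definition pos_measures :: "('a::t2_space set \<Rightarrow> complex) set" where
  "pos_measures = {\<mu> \<in> regular_measures. \<forall>E. Im (\<mu> E) = 0 \<and> Re (\<mu> E) \<ge> 0}"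

definition point_mass :: "'a::topological_space \<Rightarrow> 'a set \<Rightarrow> complex" where
  "point_mass x = (\<lambda>E. if E \<in> sets borel \<and> x \<in> E then 1 else 0)"

text \<open>
  The library measure corresponding to an element of \<^const>\<open>pos_measures\<close>; integrals and supports
  are only ever taken of non-negative measures.
\<close>

definition to_measure :: "('a::topological_space set \<Rightarrow> complex) \<Rightarrow> 'a measure" where
  "to_measure \<mu> = measure_of UNIV (sets borel) (\<lambda>E. ennreal (Re (\<mu> E)))"

definition msupport :: "('a::topological_space set \<Rightarrow> complex) \<Rightarrow> 'a set" where
  "msupport \<mu> = {x. \<forall>U. open U \<longrightarrow> x \<in> U \<longrightarrow> emeasure (to_measure \<mu>) U > 0}"


section \<open>The cone topology and the Michael topology\<close>

definition cone_test_functions :: "('a::topological_space \<Rightarrow> real) set" where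
  "cone_test_functions =
     insert (\<lambda>x. 1)
       {f. continuous_on UNIV f \<and> (\<forall>x. f x \<ge> 0) \<and> compact (closure {x. f x \<noteq> 0})}"

definition cone_topology :: "('a::t2_space set \<Rightarrow> complex) topology" where
  "cone_topology = topology_generated_by
     {{\<mu> \<in> pos_measures. integral\<^sup>L (to_measure \<mu>) f \<in> U} | f U.
        f \<in> cone_test_functions \<and> open U}"

text \<open>
  The sub-basic sets of the Michael topology never contain the empty compact set, so the whole
  space (the empty intersection of sub-basic sets) is added explicitly in order that the
  underlying set be that of all compact sets.
\<close>

definition michael_topology :: "'a::t2_space set topology" where
  "michael_topology = topology_generated_by
     (insert {C. compact C}
        {{C. compact C \<and> C \<inter> U \<noteq> {} \<and> C \<subseteq> V} | U V. open U \<and> open V})"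


section \<open>Semitopological semihypergroups\<close>

locale semitopological_semihypergroup =
  fixes conv :: "('a::t2_space set \<Rightarrow> complex) \<Rightarrow> ('a set \<Rightarrow> complex) \<Rightarrow> ('a set \<Rightarrow> complex)"
    (infixl \<open>\<star>\<close> 70)
  assumes locally_compact: "locally_compact_space (euclidean :: 'a topology)"
    and conv_closed: "\<mu> \<in> regular_measures \<Longrightarrow> \<nu> \<in> regular_measures \<Longrightarrow> \<mu> \<star> \<nu> \<in> regular_measures"
    and conv_assoc: "\<mu> \<in> regular_measures \<Longrightarrow> \<nu> \<in> regular_measures \<Longrightarrow> \<rho> \<in> regular_measures \<Longrightarrow>
          (\<mu> \<star> \<nu>) \<star> \<rho> = \<mu> \<star> (\<nu> \<star> \<rho>)"
    and conv_add_left: "\<mu> \<in> regular_measures \<Longrightarrow> \<nu> \<in> regular_measures \<Longrightarrow> \<rho> \<in> regular_measures \<Longrightarrow>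
          (\<lambda>E. \<mu> E + \<nu> E) \<star> \<rho> = (\<lambda>E. (\<mu> \<star> \<rho>) E + (\<nu> \<star> \<rho>) E)"
    and conv_add_right: "\<mu> \<in> regular_measures \<Longrightarrow> \<nu> \<in> regular_measures \<Longrightarrow> \<rho> \<in> regular_measures \<Longrightarrow>
          \<mu> \<star> (\<lambda>E. \<nu> E + \<rho> E) = (\<lambda>E. (\<mu> \<star> \<nu>) E + (\<mu> \<star> \<rho>) E)"
    and conv_scale_left: "\<mu> \<in> regular_measures \<Longrightarrow> \<nu> \<in> regular_measures \<Longrightarrow>
          (\<lambda>E. c * \<mu> E) \<star> \<nu> = (\<lambda>E. c * (\<mu> \<star> \<nu>) E)"
    and conv_scale_right: "\<mu> \<in> regular_measures \<Longrightarrow> \<nu> \<in> regular_measures \<Longrightarrow>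
          \<mu> \<star> (\<lambda>E. c * \<nu> E) = (\<lambda>E. c * (\<mu> \<star> \<nu>) E)"
    and conv_pos: "\<mu> \<in> pos_measures \<Longrightarrow> \<nu> \<in> pos_measures \<Longrightarrow> \<mu> \<star> \<nu> \<in> pos_measures"
    and conv_continuous_right: "\<omega> \<in> pos_measures \<Longrightarrow>
          continuous_map cone_topology cone_topology (\<lambda>\<mu>. \<omega> \<star> \<mu>)"
    and conv_continuous_left: "\<omega> \<in> pos_measures \<Longrightarrow>
          continuous_map cone_topology cone_topology (\<lambda>\<mu>. \<mu> \<star> \<omega>)"
    and conv_prob: "prob_space (to_measure (point_mass x \<star> point_mass y))"
    and conv_compact_support: "compact (msupport (point_mass x \<star> point_mass y))"
    and support_continuous:
          "continuous_map (euclidean :: ('a \<times> 'a) topology) michael_topology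
             (\<lambda>(x, y). msupport (point_mass x \<star> point_mass y))"


section \<open>Almost periodic functions and introversion operators\<close>

type_synonym 'a convolution = "('a set \<Rightarrow> complex) \<Rightarrow> ('a set \<Rightarrow> complex) \<Rightarrow> ('a set \<Rightarrow> complex)"

definition Ltrans :: "'a::t2_space convolution \<Rightarrow> 'a \<Rightarrow> ('a \<Rightarrow> complex) \<Rightarrow> 'a \<Rightarrow> complex" where
  "Ltrans conv x f = (\<lambda>y. integral\<^sup>L (to_measure (conv (point_mass x) (point_mass y))) f)"

definition Rtrans :: "'a::t2_space convolution \<Rightarrow> 'a \<Rightarrow> ('a \<Rightarrow> complex) \<Rightarrow> 'a \<Rightarrow> complex" where
  "Rtrans conv y f = (\<lambda>x. integral\<^sup>L (to_measure (conv (point_mass x) (point_mass y))) f)"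

text \<open>
  \<open>C(K)\<close> is the set \<^const>\<open>bcontfun\<close> of bounded continuous functions; its supremum norm is that of
  the type of bounded continuous functions. \<^const>\<open>Bcontfun\<close> is only meaningful on \<^const>\<open>bcontfun\<close>,
  hence the first conjunct below.
\<close>

definition relatively_compact_in_C :: "('a::topological_space \<Rightarrow> complex) set \<Rightarrow> bool" where
  "relatively_compact_in_C S \<longleftrightarrow> S \<subseteq> bcontfun \<and> compact (closure (Bcontfun ` S))"

definition AP_r :: "'a::t2_space convolution \<Rightarrow> ('a \<Rightarrow> complex) set" where
  "AP_r conv = {f \<in> bcontfun. relatively_compact_in_C {Rtrans conv x f | x. True}}"

definition AP_l :: "'a::t2_space convolution \<Rightarrow> ('a \<Rightarrow> complex) set" where
  "AP_l conv = {f \<in> bcontfun. relatively_compact_in_C {Ltrans conv x f | x. True}}"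

text \<open>
  For a semitopological semihypergroup the two spaces coincide; the intersection is used
  to name their common value.
\<close>

definition AP :: "'a::t2_space convolution \<Rightarrow> ('a \<Rightarrow> complex) set" where
  "AP conv = AP_l conv \<inter> AP_r conv"

text \<open>
  The bounded complex-linear functionals on a linear subspace \<open>F\<close> of \<open>C(K)\<close>. Values outside \<open>F\<close> are
  unconstrained.
\<close>

definition dual_space :: "('a::topological_space \<Rightarrow> complex) set \<Rightarrow> (('a \<Rightarrow> complex) \<Rightarrow> complex) set" where
  "dual_space F = {\<mu>.
     (\<forall>f\<in>F. \<forall>g\<in>F. \<mu> (\<lambda>x. f x + g x) = \<mu> f + \<mu> g) \<and>
     (\<forall>c. \<forall>f\<in>F. \<mu> (\<lambda>x. c * f x) = c * \<mu> f) \<and>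
     (\<exists>B. \<forall>f\<in>F. cmod (\<mu> f) \<le> B * norm (Bcontfun f))}"

definition T_op ::
  "'a::t2_space convolution \<Rightarrow> (('a \<Rightarrow> complex) \<Rightarrow> complex) \<Rightarrow> ('a \<Rightarrow> complex) \<Rightarrow> 'a \<Rightarrow> complex" where
  "T_op conv \<mu> f = (\<lambda>x. \<mu> (Ltrans conv x f))"

definition U_op ::
  "'a::t2_space convolution \<Rightarrow> (('a \<Rightarrow> complex) \<Rightarrow> complex) \<Rightarrow> ('a \<Rightarrow> complex) \<Rightarrow> 'a \<Rightarrow> complex" where
  "U_op conv \<mu> f = (\<lambda>x. \<mu> (Rtrans conv x f))"

end

theory Submission
  imports Defs
begin

text \<open>
  Write \<open>f (x * y)\<close> for the integral of \<open>f\<close> against the convolution of the point masses at \<open>x\<close> and \<open>y\<close>.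
  Viewed as a matrix in \<open>x\<close> and \<open>y\<close>, its rows are the left translates of \<open>f\<close> and its columns the
  right translates. A bounded matrix has a totally bounded set of rows iff it has a totally bounded
  set of columns (\<open>totally_bounded_family_transpose\<close>), so it is enough to control one of the two
  families of translates of \<open>T\<^sub>\<mu> f\<close>.

  For the left translates this is immediate from \<open>L\<^sub>x T\<^sub>\<mu> f = T\<^sub>\<mu> L\<^sub>x f\<close> (\<open>Ltrans_T_op\<close>): they are the image
  of the totally bounded family of the \<open>L\<^sub>x f\<close> under \<open>T\<^sub>\<mu>\<close>, which is Lipschitz with the
  constant of \<open>\<mu>\<close>. Similarly \<open>R\<^sub>z L\<^sub>x f = L\<^sub>x R\<^sub>z f\<close> shows that \<open>L\<^sub>x f\<close> is again almost periodic, so that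
  \<open>\<mu>\<close> can be applied to it in a meaningful way.

  The commutation rules come from associativity and two facts about integrals, the second of which
  concerns \<open>T\<^sub>\<mu>\<close> only. First, the integral of \<open>f\<close> against \<open>p\<^sub>x * \<nu>\<close> is the integral of \<open>L\<^sub>x f\<close> against \<open>\<nu>\<close>
  (\<open>integral_conv_point_left\<close>). This is linear in \<open>\<nu>\<close> and holds for point masses by definition. It
  extends to all \<open>\<nu>\<close> because both sides are continuous for the cone topology and finitely supported
  measures are dense in it. Continuity holds not only for the test functions that
  generate the topology but for every bounded continuous \<open>f\<close>: convergence of the total mass together
  with convergence against one compactly supported cut-off function keeps mass from
  escaping (\<open>cone_continuous_integral_nonneg\<close>). Second, \<open>\<mu>\<close> commutes with the average of the \<open>L\<^sub>t f\<close>
  over a measure (\<open>dual_integral_interchange\<close>), because total boundedness lets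
  that average be approximated in supremum norm by finite linear combinations of the \<open>L\<^sub>t f\<close>.

  The statement for \<open>U\<^sub>\<mu>\<close> is the one for \<open>T\<^sub>\<mu>\<close> in the opposite semihypergroup.
\<close>


section \<open>Quantization and total boundedness\<close>

text \<open>
  Cutting the range of each of finitely many bounded functions into small grid cells partitions the
  domain into finitely many pieces; \<open>s\<close> replaces a point by the representative of its piece. The choice
  of \<open>s\<close> depends on no measure, so that one \<open>s\<close> serves several measures at once.
\<close>

lemma finite_quantization:
  fixes H :: "('a \<Rightarrow> complex) set"
  assumes "finite H" and bdd: "\<forall>h\<in>H. bounded (range h)" and "e > 0"
  obtains s :: "'a \<Rightarrow> 'a" where "finite (range s)"
    and "\<And>h x. h \<in> H \<Longrightarrow> cmod (h x - h (s x)) \<le> e"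
    and "\<And>(M::'a measure) t. space M = UNIV \<Longrightarrow> H \<subseteq> borel_measurable M \<Longrightarrow> {x. s x = t} \<in> sets M"
proof -
  \<comment> \<open>Real and imaginary part contribute an error of \<open>d\<close> each.\<close>
  define d where "d = e / 2"
  have d: "d > 0" using \<open>e > 0\<close> by (simp add: d_def)
  define c where "c h x = (\<lfloor>Re (h x) / d\<rfloor>, \<lfloor>Im (h x) / d\<rfloor>)" for h :: "'a \<Rightarrow> complex" and x
  define q where "q x = (\<lambda>h\<in>H. c h x)" for x
  define s where "s x = (SOME y. q y = q x)" for x
  have qs: "q (s x) = q x" for x
    unfolding s_def by (rule someI[of _ x]) simp
  have fin_c: "finite (range (c h))" if hH: "h \<in> H" for h
  proof -
    obtain B where B: "\<And>x. cmod (h x) \<le> B"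
      using bspec[OF bdd hH] by (auto simp: bounded_iff)
    have *: "- B / d \<le> r / d \<and> r / d \<le> B / d" if "\<bar>r\<bar> \<le> B" for r
      using that d by (auto simp: field_simps)
    have **: "\<lfloor>r / d\<rfloor> \<in> {\<lfloor>- B / d\<rfloor>..\<lfloor>B / d\<rfloor>}" if "\<bar>r\<bar> \<le> B" for r
      using *[OF that] by (auto intro!: floor_mono)
    have "range (c h) \<subseteq> {\<lfloor>- B / d\<rfloor>..\<lfloor>B / d\<rfloor>} \<times> {\<lfloor>- B / d\<rfloor>..\<lfloor>B / d\<rfloor>}"
      unfolding c_def using B order_trans[OF abs_Re_le_cmod B] order_trans[OF abs_Im_le_cmod B]
      by (intro image_subsetI SigmaI **) auto
    then show ?thesis by (rule finite_subset) simp
  qed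
  have "range q \<subseteq> PiE H (\<lambda>h. range (c h))"
    by (auto simp: q_def)
  then have "finite (range q)"
    by (rule finite_subset) (intro finite_PiE \<open>finite H\<close> fin_c)
  then have "finite ((\<lambda>v. SOME y. q y = v) ` range q)" by simp
  moreover have "range s \<subseteq> (\<lambda>v. SOME y. q y = v) ` range q" by (auto simp: s_def)
  ultimately have 1: "finite (range s)" by (rule rev_finite_subset)
  have 2: "cmod (h x - h (s x)) \<le> e" if "h \<in> H" for h x
  proof -
    have cc: "c h (s x) = c h x" using fun_cong[OF qs[of x], of h] that by (simp add: q_def)
    have *: "\<bar>a - b\<bar> \<le> d" if "\<lfloor>a / d\<rfloor> = \<lfloor>b / d\<rfloor>" for a b
    proof -
      have "\<bar>a / d - b / d\<bar> \<le> 1" using that by linarith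
      then show ?thesis using d by (simp add: field_simps abs_if split: if_splits)
    qed
    have "cmod (h x - h (s x)) \<le> \<bar>Re (h x) - Re (h (s x))\<bar> + \<bar>Im (h x) - Im (h (s x))\<bar>"
      using cmod_le[of "h x - h (s x)"] by simp
    also have "\<dots> \<le> d + d" using cc by (intro add_mono *) (auto simp: c_def)
    finally show ?thesis by (simp add: d_def)
  qed
  \<comment> \<open>A non-empty fibre of \<open>s\<close> is a fibre of \<open>q\<close>, hence a finite intersection of preimages of grid cells.\<close>
  have 3: "{x. s x = t} \<in> sets M" if M: "space M = UNIV" "H \<subseteq> borel_measurable M" for M :: "'a measure" and t
  proof -
    have "{x. s x = t} = (if s t = t then {x. q x = q t} else {})"
    proof -
      have *: "s x = s y" if "q x = q y" for x y
        unfolding s_def that ..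
      have ss: "s (s x) = s x" for x by (rule *) (rule qs)
      show ?thesis
      proof (cases "s t = t")
        case True
        have "s x = t \<longleftrightarrow> q x = q t" for x
          using *[of x t] qs[of x] True by metis
        then show ?thesis using True by simp
      next
        case False
        then have "s x \<noteq> t" for x using ss[of x] by metis
        then show ?thesis using False by simp
      qed
    qed
    moreover have "{x. q x = q t} = space M \<inter> (\<Inter>h\<in>H. {x \<in> space M. c h x = c h t})"
    proof -
      have "q x = q t \<longleftrightarrow> (\<forall>h\<in>H. c h x = c h t)" for x
      proof
        assume "q x = q t"
        show "\<forall>h\<in>H. c h x = c h t"
        proof
          fix h assume "h \<in> H"
          then show "c h x = c h t" using fun_cong[OF \<open>q x = q t\<close>, of h] by (simp add: q_def)
        qed
      next
        assume "\<forall>h\<in>H. c h x = c h t"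
        then show "q x = q t" unfolding q_def by (intro restrict_ext) simp
      qed
      then show ?thesis by (auto simp: M(1))
    qed
    moreover have "{x \<in> space M. c h x = c h t} \<in> sets M" if "h \<in> H" for h
    proof -
      have [measurable]: "h \<in> borel_measurable M" using that M by auto
      show ?thesis unfolding c_def prod.inject by measurable
    qed
    moreover from this have "space M \<inter> (\<Inter>h\<in>H. {x \<in> space M. c h x = c h t}) \<in> sets M"
      using \<open>finite H\<close> by (cases "H = {}") (auto intro!: sets.finite_INT)
    ultimately show ?thesis by simp
  qed
  show thesis using that[OF 1 2 3] by blast
qed

text \<open>
  The finite sum is the integral of \<open>h \<circ> s\<close>, which is uniformly close to \<open>h\<close>.
\<close>

lemma integral_quantized:
  fixes h :: "'a \<Rightarrow> complex"
  assumes "finite_measure M" and M: "space M = UNIV"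
    and fin: "finite (range s)" and s: "\<And>t. {x. s x = t} \<in> sets M"
    and h[measurable]: "h \<in> borel_measurable M" and bdd: "bounded (range h)"
    and e: "\<And>x. cmod (h x - h (s x)) \<le> e"
  shows "cmod (integral\<^sup>L M h - (\<Sum>t\<in>range s. complex_of_real (measure M {x. s x = t}) * h t))
           \<le> e * measure M UNIV"
proof -
  interpret finite_measure M by fact
  have hs: "h (s x) = (\<Sum>t\<in>range s. indicator {x. s x = t} x *\<^sub>R h t)" for x
  proof -
    have "(\<Sum>t\<in>range s. indicator {x. s x = t} x *\<^sub>R h t) = (\<Sum>t\<in>range s. if t = s x then h t else 0)"
      by (intro sum.cong) (auto simp: indicator_def)
    then show ?thesis using fin by simp
  qed
  have sb: "has_bochner_integral M (\<lambda>x. h (s x)) (\<Sum>t\<in>range s. measure M {x. s x = t} *\<^sub>R h t)"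
    unfolding hs
    by (intro has_bochner_integral_sum has_bochner_integral_scaleR_left has_bochner_integral_real_indicator s)
       (simp add: less_top[symmetric])
  obtain B where B: "\<And>x. cmod (h x) \<le> B"
    using bdd by (auto simp: bounded_iff)
  have ih: "integrable M h"
    by (rule integrable_const_bound[of _ B]) (auto simp: B)
  have "integral\<^sup>L M h - (\<Sum>t\<in>range s. measure M {x. s x = t} *\<^sub>R h t) = (\<integral>x. h x - h (s x) \<partial>M)"
    using sb ih by (simp add: has_bochner_integral_iff)
  also have "cmod \<dots> \<le> (\<integral>x. e \<partial>M)"
    using sb ih by (intro order_trans[OF integral_norm_bound integral_mono]) (auto simp: has_bochner_integral_iff e)
  finally show ?thesis by (simp add: M scaleR_conv_of_real mult.commute)
qed

text \<open>
  Total boundedness for the supremum distance. The centres are not required to belong to the family,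
  which makes closure under linear combinations immediate.
\<close>

definition totally_bounded_family :: "('b \<Rightarrow> complex) set \<Rightarrow> bool" where
  "totally_bounded_family S \<longleftrightarrow>
     (\<forall>e>0. \<exists>H. finite H \<and> (\<forall>f\<in>S. \<exists>h\<in>H. \<forall>x. cmod (f x - h x) \<le> e))"

lemma totally_bounded_familyE:
  assumes "totally_bounded_family (range F)" "e > 0"
  obtains Y where "finite Y" "\<And>y. \<exists>y'\<in>Y. \<forall>x. cmod (F y x - F y' x) \<le> e"
proof -
  obtain H where H: "finite H" "\<And>y. \<exists>h\<in>H. \<forall>x. cmod (F y x - h x) \<le> e / 2"
    using assms unfolding totally_bounded_family_def by (metis half_gt_zero rangeI)
  define r where "r h = (SOME y. \<forall>x. cmod (F y x - h x) \<le> e / 2)" for h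
  have "\<exists>y'\<in>r ` H. \<forall>x. cmod (F y x - F y' x) \<le> e" for y
  proof -
    obtain h where h: "h \<in> H" "\<forall>x. cmod (F y x - h x) \<le> e / 2" using H(2) by blast
    have r: "\<forall>x. cmod (F (r h) x - h x) \<le> e / 2"
      unfolding r_def by (rule someI[of _ y]) (use h in blast)
    have "cmod (F y x - F (r h) x) \<le> e" for x
      using norm_triangle_ineq4[of "F y x - h x" "F (r h) x - h x"] h(2)[rule_format, of x] r[rule_format, of x] by simp
    then show ?thesis using h(1) by blast
  qed
  then show thesis using that[of "r ` H"] H(1) by blast
qed

text \<open>
  A finite net of rows \<open>F y\<close> with \<open>y \<in> Y\<close> consists of finitely many bounded functions. Two points \<open>x\<close> that
  this net cannot tell apart up to \<open>e / 3\<close> give columns that differ by at most \<open>e\<close>, and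
  quantization shows that finitely many points suffice.
\<close>

lemma totally_bounded_family_transpose:
  assumes tb: "totally_bounded_family (range F)" and bdd: "\<And>y. bounded (range (F y))"
  shows "totally_bounded_family (range (\<lambda>x y. F y x))"
  unfolding totally_bounded_family_def
proof (intro allI impI)
  fix e :: real assume "e > 0"
  then obtain Y where Y: "finite Y" "\<And>y. \<exists>y'\<in>Y. \<forall>x. cmod (F y x - F y' x) \<le> e / 3"
    using totally_bounded_familyE[OF tb, of "e / 3"] by auto
  have f: "finite (F ` Y)" "\<forall>h\<in>F ` Y. bounded (range h)" "e / 3 > 0"
    using Y(1) bdd \<open>e > 0\<close> by auto
  obtain s where s: "finite (range s)" "\<And>h x. h \<in> F ` Y \<Longrightarrow> cmod (h x - h (s x)) \<le> e / 3"
    by (rule finite_quantization[OF f]) (rule that)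
  have "cmod (F y x - F y (s x)) \<le> e" for x y
  proof -
    obtain y' where y': "y' \<in> Y" "\<forall>x. cmod (F y x - F y' x) \<le> e / 3" using Y(2) by blast
    have "F y x - F y (s x) = (F y x - F y' x) + (F y' x - F y' (s x)) - (F y (s x) - F y' (s x))" by simp
    also have "cmod \<dots> \<le> e / 3 + e / 3 + e / 3"
      by (intro norm_triangle_le_diff norm_triangle_le add_mono order_refl s y'(2)[rule_format] imageI y'(1))
    finally show ?thesis by simp
  qed
  then show "\<exists>H. finite H \<and> (\<forall>f\<in>range (\<lambda>x y. F y x). \<exists>h\<in>H. \<forall>x. cmod (f x - h x) \<le> e)"
    using s(1) by (intro exI[of _ "(\<lambda>x y. F y x) ` range s"]) auto
qed

lemma totally_bounded_family_combination:
  assumes F: "totally_bounded_family (range F)" and G: "totally_bounded_family (range G)"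
  shows "totally_bounded_family (range (\<lambda>y x. a * F y x + b * G y x))"
  unfolding totally_bounded_family_def
proof (intro allI impI)
  fix e :: real assume "e > 0"
  define d where "d = e / (cmod a + cmod b + 1)"
  have p: "cmod a + cmod b + 1 > 0" by (simp add: add_nonneg_pos)
  have "d > 0" using \<open>e > 0\<close> p by (simp add: d_def)
  obtain H1 where H1: "finite H1" "\<And>y. \<exists>h\<in>H1. \<forall>x. cmod (F y x - h x) \<le> d"
    using F \<open>d > 0\<close> unfolding totally_bounded_family_def by (metis rangeI)
  obtain H2 where H2: "finite H2" "\<And>y. \<exists>h\<in>H2. \<forall>x. cmod (G y x - h x) \<le> d"
    using G \<open>d > 0\<close> unfolding totally_bounded_family_def by (metis rangeI)
  let ?H = "(\<lambda>(h1, h2) x. a * h1 x + b * h2 x) ` (H1 \<times> H2)"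
  have "\<exists>h\<in>?H. \<forall>x. cmod (a * F y x + b * G y x - h x) \<le> e" for y
  proof -
    obtain h1 where h1: "h1 \<in> H1" "\<And>x. cmod (F y x - h1 x) \<le> d" using H1(2) by blast
    obtain h2 where h2: "h2 \<in> H2" "\<And>x. cmod (G y x - h2 x) \<le> d" using H2(2) by blast
    have "cmod (a * F y x + b * G y x - (a * h1 x + b * h2 x)) \<le> e" for x
    proof -
      have "a * F y x + b * G y x - (a * h1 x + b * h2 x) = a * (F y x - h1 x) + b * (G y x - h2 x)"
        by (simp add: algebra_simps)
      also have "cmod \<dots> \<le> cmod a * d + cmod b * d"
        by (intro norm_triangle_le add_mono) (auto simp: norm_mult intro!: mult_left_mono h1 h2)
      also have "\<dots> \<le> (cmod a + cmod b + 1) * d" using \<open>d > 0\<close> by (simp add: algebra_simps)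
      also have "\<dots> = e" using p by (simp add: d_def)
      finally show ?thesis .
    qed
    then show ?thesis using h1(1) h2(1) by (intro bexI[of _ "\<lambda>x. a * h1 x + b * h2 x"]) auto
  qed
  then show "\<exists>H. finite H \<and> (\<forall>f\<in>range (\<lambda>y x. a * F y x + b * G y x). \<exists>h\<in>H. \<forall>x. cmod (f x - h x) \<le> e)"
    using H1(1) H2(1) by (intro exI[of _ ?H]) auto
qed

text \<open>
  The hypothesis says that \<open>F y \<mapsto> G y\<close> is Lipschitz with constant \<open>C\<close>.
\<close>

lemma totally_bounded_family_image:
  assumes F: "totally_bounded_family (range F)"
    and lip: "\<And>y y' d. (\<And>x. cmod (F y x - F y' x) \<le> d) \<Longrightarrow> (\<And>x. cmod (G y x - G y' x) \<le> C * d)"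
  shows "totally_bounded_family (range G)"
  unfolding totally_bounded_family_def
proof (intro allI impI)
  fix e :: real assume "e > 0"
  define d where "d = e / (\<bar>C\<bar> + 1)"
  have d: "d > 0" "C * d \<le> e"
  proof -
    show "d > 0" using \<open>e > 0\<close> by (simp add: d_def add_nonneg_pos)
    then have "C * d \<le> (\<bar>C\<bar> + 1) * d" by (intro mult_right_mono) auto
    also have "\<dots> = e" by (simp add: d_def)
    finally show "C * d \<le> e" .
  qed
  obtain Y where Y: "finite Y" "\<And>y. \<exists>y'\<in>Y. \<forall>x. cmod (F y x - F y' x) \<le> d"
    using totally_bounded_familyE[OF F d(1)] by auto
  have "\<exists>y'\<in>Y. \<forall>x. cmod (G y x - G y' x) \<le> e" for y
    using Y(2)[of y] lip d(2) order_trans by meson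
  then show "\<exists>H. finite H \<and> (\<forall>f\<in>range G. \<exists>h\<in>H. \<forall>x. cmod (f x - h x) \<le> e)"
    using Y(1) by (intro exI[of _ "G ` Y"]) auto
qed

text \<open>
  Completeness of the space of bounded continuous functions on an arbitrary topological space: a
  uniform limit of continuous functions is continuous.
\<close>

lemma closed_imp_complete_bcontfun:
  fixes S :: "('a::topological_space \<Rightarrow>\<^sub>C 'b::complete_space) set"
  assumes "closed S"
  shows "uniform_space_class.complete S"
proof (rule completeI)
  fix f :: "nat \<Rightarrow> ('a, 'b) bcontfun"
  assume f: "\<forall>n. f n \<in> S" "Cauchy f"
  have "\<exists>N. \<forall>m n x. N \<le> m \<and> N \<le> n \<and> True \<longrightarrow> dist (f m x) (f n x) < e" if "e > 0" for e
  proof -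
    obtain N where "\<forall>m\<ge>N. \<forall>n\<ge>N. dist (f m) (f n) < e" using f(2) \<open>e > 0\<close> unfolding Cauchy_def by blast
    then show ?thesis by (intro exI[of _ N]) (auto intro: dist_fun_lt_imp_dist_val_lt)
  qed
  then obtain g where "uniform_limit UNIV f g sequentially"
    using uniformly_convergent_eq_cauchy[of "\<lambda>_. True" f]
    unfolding uniform_limit_sequentially_iff by auto
  from uniform_limit_bcontfunE[OF this sequentially_bot] obtain l where "f \<longlonglongrightarrow> l" by blast
  then show "\<exists>l\<in>S. f \<longlonglongrightarrow> l"
    using closed_sequentially[OF assms] f(1) by blast
qed

lemma relatively_compact_in_C_iff:
  fixes F :: "'b \<Rightarrow> 'a::topological_space \<Rightarrow> complex"
  assumes F: "\<And>y. F y \<in> bcontfun"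
  shows "relatively_compact_in_C (range F) \<longleftrightarrow> totally_bounded_family (range F)"
proof
  assume "relatively_compact_in_C (range F)"
  then have "compact (closure (Bcontfun ` range F))" by (simp add: relatively_compact_in_C_def)
  then have k: "\<And>e. e > 0 \<Longrightarrow> \<exists>k. finite k \<and> closure (Bcontfun ` range F) \<subseteq> (\<Union>x\<in>k. ball x e)"
    by (simp add: compact_eq_totally_bounded)
  show "totally_bounded_family (range F)"
    unfolding totally_bounded_family_def
  proof (intro allI impI)
    fix e :: real assume "e > 0"
    then obtain k where k: "finite k" "closure (Bcontfun ` range F) \<subseteq> (\<Union>x\<in>k. ball x e)"
      using k by blast
    have "\<exists>h\<in>apply_bcontfun ` k. \<forall>x. cmod (F y x - h x) \<le> e" for y
    proof -
      have "Bcontfun (F y) \<in> closure (Bcontfun ` range F)" by (simp add: closure_subset[THEN subsetD])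
      then obtain g where "g \<in> k" "Bcontfun (F y) \<in> ball g e" using k(2) by blast
      then have g: "g \<in> k" "dist (Bcontfun (F y)) g \<le> e" by (auto simp: dist_commute)
      have "cmod (F y x - apply_bcontfun g x) \<le> e" for x
        using dist_bounded[of "Bcontfun (F y)" x g] g(2) by (simp add: F Bcontfun_inverse dist_norm)
      then show ?thesis using g(1) by blast
    qed
    then show "\<exists>H. finite H \<and> (\<forall>f\<in>range F. \<exists>h\<in>H. \<forall>x. cmod (f x - h x) \<le> e)"
      using k(1) by (intro exI[of _ "apply_bcontfun ` k"]) auto
  qed
next
  assume tb: "totally_bounded_family (range F)"
  have "\<exists>k. finite k \<and> closure (Bcontfun ` range F) \<subseteq> (\<Union>x\<in>k. ball x e)" if "e > 0" for e
  proof -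
    obtain Y where Y: "finite Y" "\<And>y. \<exists>y'\<in>Y. \<forall>x. cmod (F y x - F y' x) \<le> e / 2"
      using totally_bounded_familyE[OF tb half_gt_zero[OF \<open>e > 0\<close>]] by blast
    let ?k = "(Bcontfun \<circ> F) ` Y"
    have "Bcontfun (F y) \<in> (\<Union>g\<in>?k. cball g (e / 2))" for y
    proof -
      obtain y' where y': "y' \<in> Y" "\<forall>x. cmod (F y x - F y' x) \<le> e / 2" using Y(2) by blast
      have "dist (Bcontfun (F y')) (Bcontfun (F y)) \<le> e / 2"
        by (rule dist_bound) (use y' in \<open>auto simp: F Bcontfun_inverse dist_norm norm_minus_commute\<close>)
      then show ?thesis using y'(1) by auto
    qed
    then have "Bcontfun ` range F \<subseteq> (\<Union>g\<in>?k. cball g (e / 2))" by auto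
    moreover have "closed (\<Union>g\<in>?k. cball g (e / 2))" using Y(1) by (intro closed_UN) auto
    ultimately have "closure (Bcontfun ` range F) \<subseteq> (\<Union>g\<in>?k. cball g (e / 2))" by (rule closure_minimal)
    also have "\<dots> \<subseteq> (\<Union>g\<in>?k. ball g e)" 
      using that by (intro UN_mono order_refl cball_subset_ball_iff[THEN iffD2]) auto
    finally show ?thesis using Y(1) by (intro exI[of _ ?k]) auto
  qed
  then show "relatively_compact_in_C (range F)"
    using F closed_imp_complete_bcontfun[OF closed_closure, of "Bcontfun ` range F"]
    by (auto simp: relatively_compact_in_C_def compact_eq_totally_bounded)
qed

section \<open>Non-negative measures\<close>

text \<open>
  Non-negativity without regularity, so that regularity of a measure can be derived from its values.
\<close>

definition nonneg_borel_measure :: "('a::topological_space set \<Rightarrow> complex) \<Rightarrow> bool" where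
  "nonneg_borel_measure \<mu> \<longleftrightarrow> complex_borel_measure \<mu> \<and> (\<forall>E. Im (\<mu> E) = 0 \<and> Re (\<mu> E) \<ge> 0)"

lemma pos_measures_iff:
  "\<mu> \<in> pos_measures \<longleftrightarrow> nonneg_borel_measure \<mu> \<and> regular_borel_measure \<mu>"
  by (auto simp: pos_measures_def nonneg_borel_measure_def regular_measures_def)

lemma sets_to_measure[simp, measurable_cong]: "sets (to_measure \<mu>) = sets borel"
  unfolding to_measure_def by (simp add: sets_measure_of_conv sets.sigma_sets_eq[of borel, simplified])

lemma space_to_measure[simp]: "space (to_measure \<mu>) = UNIV"
  unfolding to_measure_def by (simp add: space_measure_of_conv)

lemma borel_measurable_to_measure[simp]: "borel_measurable (to_measure \<mu>) = borel_measurable borel"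
  by (rule measurable_cong_sets) simp_all

lemma emeasure_to_measure:
  assumes "nonneg_borel_measure \<mu>"
  shows "emeasure (to_measure \<mu>) E = ennreal (Re (\<mu> E))"
proof (cases "E \<in> sets borel")
  case True
  have cb: "complex_borel_measure \<mu>" and nn: "\<And>E. Re (\<mu> E) \<ge> 0"
    using assms by (auto simp: nonneg_borel_measure_def)
  have sums: "(\<lambda>i. \<mu> (A i)) sums \<mu> (\<Union>i. A i)" if "range A \<subseteq> sets borel" "disjoint_family A" for A :: "nat \<Rightarrow> _"
    using cb that unfolding complex_borel_measure_def by blast
  have "(\<lambda>i::nat. \<mu> {}) sums \<mu> (\<Union>i::nat. {})"
    by (rule sums) (auto simp: disjoint_family_on_def)
  then have "(\<lambda>i::nat. \<mu> {}) \<longlonglongrightarrow> 0" by (intro summable_LIMSEQ_zero sums_summable)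
  then have "\<mu> {} = 0" by (simp add: LIMSEQ_const_iff)
  show ?thesis
    unfolding to_measure_def
  proof (rule emeasure_measure_of_sigma[OF _ _ _ True])
    show "sigma_algebra UNIV (sets borel :: 'a set set)"
      using sets.sigma_algebra_axioms[of borel] by simp
    show "positive (sets borel) (\<lambda>E. ennreal (Re (\<mu> E)))"
      using \<open>\<mu> {} = 0\<close> by (simp add: positive_def)
    show "countably_additive (sets borel) (\<lambda>E. ennreal (Re (\<mu> E)))"
    proof (rule countably_additiveI)
      fix A :: "nat \<Rightarrow> 'a set"
      assume "range A \<subseteq> sets borel" "disjoint_family A"
      from sums_Re[OF sums[OF this]] show "(\<Sum>i. ennreal (Re (\<mu> (A i)))) = ennreal (Re (\<mu> (\<Union>i. A i)))"
        by (intro suminf_ennreal_eq nn)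
    qed
  qed
next
  case False
  then have "\<mu> E = 0" using assms by (simp add: nonneg_borel_measure_def complex_borel_measure_def)
  then show ?thesis using False by (simp add: emeasure_notin_sets)
qed

lemma measure_to_measure:
  "nonneg_borel_measure \<mu> \<Longrightarrow> measure (to_measure \<mu>) E = Re (\<mu> E)"
  by (simp add: measure_def emeasure_to_measure) (simp add: nonneg_borel_measure_def)

lemma finite_measure_to_measure:
  "nonneg_borel_measure \<mu> \<Longrightarrow> finite_measure (to_measure \<mu>)"
  by (rule finite_measureI) (simp add: emeasure_to_measure)

text \<open>
  Every partition of \<open>E\<close> already gives the full mass of \<open>E\<close>.
\<close>

lemma total_variation_nonneg:
  assumes \<mu>: "nonneg_borel_measure \<mu>" and E: "E \<in> sets borel"
  shows "total_variation \<mu> E = ennreal (Re (\<mu> E))"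
proof -
  let ?P = "{A :: nat \<Rightarrow> 'a set. range A \<subseteq> sets borel \<and> disjoint_family A \<and> (\<Union>i. A i) = E}"
  have "(\<lambda>i. if i = 0 then E else {}) \<in> ?P"
    using E by (auto simp: disjoint_family_on_def split: if_splits)
  then have ne: "?P \<noteq> {}" by blast
  have "(\<Sum>i. ennreal (cmod (\<mu> (A i)))) = ennreal (Re (\<mu> E))" if "A \<in> ?P" for A
  proof -
    have "cmod (\<mu> B) = Re (\<mu> B)" for B
      using \<mu> by (simp add: nonneg_borel_measure_def cmod_def)
    then have "(\<Sum>i. ennreal (cmod (\<mu> (A i)))) = (\<Sum>i. emeasure (to_measure \<mu>) (A i))"
      by (simp add: emeasure_to_measure[OF \<mu>])
    also have "\<dots> = emeasure (to_measure \<mu>) (\<Union>i. A i)"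
      using that by (intro suminf_emeasure) auto
    finally show ?thesis using that by (simp add: emeasure_to_measure[OF \<mu>])
  qed
  then have "total_variation \<mu> E = (SUP A \<in> ?P. ennreal (Re (\<mu> E)))"
    unfolding total_variation_def by (rule SUP_cong[OF refl])
  then show ?thesis by (simp only: cSUP_const[OF ne])
qed

text \<open>
  Inner regularity at the whole space.
\<close>

lemma pos_measures_tight:
  fixes \<mu> :: "'a::t2_space set \<Rightarrow> complex"
  assumes "\<mu> \<in> pos_measures" "e > 0"
  obtains C where "compact C" "measure (to_measure \<mu>) (UNIV - C) \<le> e"
proof -
  have nn: "nonneg_borel_measure \<mu>" and reg: "regular_borel_measure \<mu>"
    using assms(1) by (auto simp: pos_measures_iff)
  interpret finite_measure "to_measure \<mu>" by (rule finite_measure_to_measure[OF nn])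
  have cs: "C \<in> sets borel" if "compact C" for C :: "'a set"
    using that by (simp add: borel_closed compact_imp_closed)
  have "\<exists>C. compact C \<and> Re (\<mu> UNIV) - e \<le> Re (\<mu> C)"
  proof (cases "Re (\<mu> UNIV) \<le> e")
    case True
    then show ?thesis using nn by (intro exI[of _ "{}"]) (auto simp: nonneg_borel_measure_def intro: order_trans[of _ 0])
  next
    case False
    have "ennreal (Re (\<mu> UNIV) - e) < ennreal (Re (\<mu> UNIV))"
      using \<open>e > 0\<close> False by (intro ennreal_lessI) auto
    also have "\<dots> = total_variation \<mu> UNIV" using total_variation_nonneg[OF nn, of UNIV] by simp
    also have "\<dots> = (SUP C \<in> {C. compact C \<and> C \<subseteq> UNIV}. total_variation \<mu> C)"
      using reg unfolding regular_borel_measure_def by (meson UNIV_I sets_UNIV borel_open open_UNIV)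
    finally obtain C where C: "compact C" "ennreal (Re (\<mu> UNIV) - e) < total_variation \<mu> C"
      unfolding less_SUP_iff by blast
    have "Re (\<mu> UNIV) - e \<le> Re (\<mu> C)"
      using C(2) False nn unfolding total_variation_nonneg[OF nn cs[OF C(1)]]
      by (simp add: ennreal_less_iff nonneg_borel_measure_def less_imp_le)
    then show ?thesis using C(1) by blast
  qed
  then obtain C where C: "compact C" "Re (\<mu> UNIV) - e \<le> Re (\<mu> C)" by blast
  have "measure (to_measure \<mu>) (UNIV - C) = Re (\<mu> UNIV) - Re (\<mu> C)"
    using finite_measure_compl[of C] cs[OF C(1)] by (simp add: measure_to_measure[OF nn])
  then show thesis using that[OF C(1)] C(2) by simp
qed

lemma integrable_to_measure:
  fixes h :: "'a::topological_space \<Rightarrow> 'b::{banach, second_countable_topology}"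
  assumes "nonneg_borel_measure \<mu>" "h \<in> borel_measurable borel" "bounded (range h)"
  shows "integrable (to_measure \<mu>) h"
proof -
  interpret finite_measure "to_measure \<mu>" by (rule finite_measure_to_measure) fact
  obtain B where B: "\<And>x. norm (h x) \<le> B"
    using assms(3) by (auto simp: bounded_iff)
  show ?thesis
    by (rule integrable_const_bound[of _ B]) (use assms(2) in \<open>simp_all add: B\<close>)
qed

text \<open>
  Integration is linear in the measure: a common quantization of \<open>h\<close> reduces the claim, up to an
  arbitrarily small error, to finite sums of values of the measures, where it is the
  hypothesis \<open>eq\<close>.
\<close>

lemma integral_combination:
  fixes h :: "'a::topological_space \<Rightarrow> complex"
  assumes T: "finite T" and \<rho>: "nonneg_borel_measure \<rho>" and \<mu>: "\<And>t. t \<in> T \<Longrightarrow> nonneg_borel_measure (\<mu> t)"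
    and c: "\<And>t. t \<in> T \<Longrightarrow> c t \<ge> 0"
    and eq: "\<rho> = (\<lambda>E. \<Sum>t\<in>T. complex_of_real (c t) * \<mu> t E)"
    and h: "h \<in> borel_measurable borel" "bounded (range h)"
  shows "integral\<^sup>L (to_measure \<rho>) h = (\<Sum>t\<in>T. complex_of_real (c t) * integral\<^sup>L (to_measure (\<mu> t)) h)"
    (is "?l = ?r")
proof -
  define m where "m = Re (\<rho> UNIV)"
  have m0: "m \<ge> 0" using \<rho> by (simp add: m_def nonneg_borel_measure_def)
  have Re_eq: "Re (\<rho> E) = (\<Sum>t\<in>T. c t * Re (\<mu> t E))" for E
    unfolding eq by simp
  have main: "cmod (?l - ?r) \<le> e * (2 * m)" if e: "e > 0" for e
  proof -
    obtain s where s: "finite (range s)" "\<And>x. cmod (h x - h (s x)) \<le> e"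
      and ms: "\<And>(M::'a measure) t. space M = UNIV \<Longrightarrow> h \<in> borel_measurable M \<Longrightarrow> {x. s x = t} \<in> sets M"
      by (rule finite_quantization[of "{h}" e]) (use h(2) e in auto)
    define S where "S \<nu> = (\<Sum>t\<in>range s. complex_of_real (Re (\<nu> {x. s x = t})) * h t)" for \<nu> :: "'a set \<Rightarrow> complex"
    have app: "cmod (integral\<^sup>L (to_measure \<nu>) h - S \<nu>) \<le> e * Re (\<nu> UNIV)" if "nonneg_borel_measure \<nu>" for \<nu>
      using integral_quantized[OF finite_measure_to_measure[OF that], of s h e] s ms[of "to_measure \<nu>"] h
      unfolding S_def measure_to_measure[OF that] by simp
    have S: "S \<rho> = (\<Sum>t\<in>T. complex_of_real (c t) * S (\<mu> t))"
      unfolding S_def Re_eq of_real_sum of_real_mult sum_distrib_left sum_distrib_right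
      by (subst sum.swap) (simp add: mult.assoc)
    have "?l - ?r = (?l - S \<rho>) - (\<Sum>t\<in>T. complex_of_real (c t) * (integral\<^sup>L (to_measure (\<mu> t)) h - S (\<mu> t)))"
      unfolding S by (simp add: right_diff_distrib sum_subtractf)
    also have "cmod \<dots> \<le> e * m + (\<Sum>t\<in>T. c t * (e * Re (\<mu> t UNIV)))"
    proof (rule order_trans[OF norm_triangle_ineq4 add_mono[OF _ sum_norm_le]])
      show "cmod (?l - S \<rho>) \<le> e * m" unfolding m_def by (rule app[OF \<rho>])
      show "cmod (complex_of_real (c t) * (integral\<^sup>L (to_measure (\<mu> t)) h - S (\<mu> t))) \<le> c t * (e * Re (\<mu> t UNIV))"
        if "t \<in> T" for t
        using app[OF \<mu>[OF that]] c[OF that] by (simp add: norm_mult mult_left_mono)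
    qed
    also have "(\<Sum>t\<in>T. c t * (e * Re (\<mu> t UNIV))) = e * m"
      unfolding m_def Re_eq by (simp add: sum_distrib_left mult_ac)
    finally show ?thesis by simp
  qed
  have "cmod (?l - ?r) \<le> 0 + d" if "d > 0" for d
  proof -
    have "d / (2 * m + 1) > 0" using m0 that by simp
    from main[OF this] have "cmod (?l - ?r) \<le> d * ((2 * m) / (2 * m + 1))" by simp
    also have "\<dots> \<le> d * 1" using m0 that by (intro mult_left_mono) auto
    finally show ?thesis by simp
  qed
  then have "cmod (?l - ?r) \<le> 0" by (rule field_le_epsilon)
  then show ?thesis by simp
qed

lemma point_mass_sums:
  assumes "range A \<subseteq> sets borel" "disjoint_family A"
  shows "(\<lambda>i. point_mass x (A i)) sums point_mass x (\<Union>i. A i)"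
proof (cases "x \<in> (\<Union>i. A i)")
  case True
  then obtain i where i: "x \<in> A i" by blast
  have "point_mass x (A j) = (if j = i then 1 else 0)" for j
    using assms i by (auto simp: point_mass_def disjoint_family_on_def)
  moreover have "point_mass x (\<Union>i. A i) = 1"
    using True assms by (auto simp: point_mass_def)
  ultimately show ?thesis using sums_single[of i "\<lambda>_. 1 :: complex"] by simp
next
  case False
  then have "point_mass x (A i) = 0" for i by (auto simp: point_mass_def)
  moreover have "point_mass x (\<Union>i. A i) = 0" using False by (auto simp: point_mass_def)
  ultimately show ?thesis by simp
qed

definition discrete_measure :: "('a::topological_space \<Rightarrow> real) \<Rightarrow> 'a set \<Rightarrow> 'a set \<Rightarrow> complex" where
  "discrete_measure c T = (\<lambda>E. \<Sum>t\<in>T. complex_of_real (c t) * point_mass t E)"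

text \<open>
  Such a measure sees a set only through its intersection with the finite set \<open>T\<close>. Hence the compact set
  \<open>T \<inter> E\<close> and the open set \<open>- (T - E)\<close> have the same mass as \<open>E\<close>.
\<close>

lemma discrete_measure_pos:
  fixes T :: "'a::t2_space set"
  assumes T: "finite T" and c: "\<And>t. t \<in> T \<Longrightarrow> c t \<ge> 0"
  shows "discrete_measure c T \<in> pos_measures"
proof -
  let ?\<mu> = "discrete_measure c T"
  have "(\<lambda>i. ?\<mu> (A i)) sums ?\<mu> (\<Union>i. A i)" if "range A \<subseteq> sets borel" "disjoint_family A" for A
    unfolding discrete_measure_def by (intro sums_sum sums_mult point_mass_sums that)
  then have nn: "nonneg_borel_measure ?\<mu>"
    using c by (auto simp: nonneg_borel_measure_def complex_borel_measure_def discrete_measure_def point_mass_def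
        if_distrib[of Im] if_distrib[of Re] cong: if_cong intro!: sum_nonneg)
  have cong: "?\<mu> E = ?\<mu> F" if "E \<in> sets borel" "F \<in> sets borel" "E \<inter> T = F \<inter> T" for E F
    unfolding discrete_measure_def by (intro sum.cong refl) (use that in \<open>auto simp: point_mass_def\<close>)
  have mono: "Re (?\<mu> E) \<le> Re (?\<mu> F)" if "E \<in> sets borel" "F \<in> sets borel" "E \<subseteq> F" for E F
    unfolding discrete_measure_def Re_sum by (intro sum_mono) (use that c in \<open>auto simp: point_mass_def\<close>)
  have "regular_borel_measure ?\<mu>"
    unfolding regular_borel_measure_def
  proof (intro ballI conjI antisym)
    fix E :: "'a set" assume E: "E \<in> sets borel"
    let ?U = "- (T - E)" and ?C = "T \<inter> E"
    have U: "open ?U" using T by (intro open_Compl finite_imp_closed) auto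
    have C: "compact ?C" using T by (intro finite_imp_compact) auto
    have Cb: "?C \<in> sets borel" using C by (simp add: borel_closed compact_imp_closed)
    have le: "total_variation ?\<mu> A \<le> total_variation ?\<mu> B" if "A \<in> sets borel" "B \<in> sets borel" "A \<subseteq> B" for A B
      using that by (simp add: total_variation_nonneg[OF nn] mono ennreal_leI)
    show "total_variation ?\<mu> E \<le> (INF U \<in> {U. open U \<and> E \<subseteq> U}. total_variation ?\<mu> U)"
      using E by (intro INF_greatest le) auto
    show "(SUP C \<in> {C. compact C \<and> C \<subseteq> E}. total_variation ?\<mu> C) \<le> total_variation ?\<mu> E"
      using E by (intro SUP_least le) (auto simp: borel_closed compact_imp_closed)
    have "(INF U \<in> {U. open U \<and> E \<subseteq> U}. total_variation ?\<mu> U) \<le> total_variation ?\<mu> ?U"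
      using U by (intro INF_lower) auto
    also have "\<dots> = total_variation ?\<mu> E"
    proof -
      have "?U \<inter> T = E \<inter> T" by blast
      then have "?\<mu> ?U = ?\<mu> E" using E U by (intro cong) auto
      then show ?thesis using E U by (simp add: total_variation_nonneg[OF nn])
    qed
    finally show "(INF U \<in> {U. open U \<and> E \<subseteq> U}. total_variation ?\<mu> U) \<le> total_variation ?\<mu> E" .
    have "total_variation ?\<mu> E = total_variation ?\<mu> ?C"
    proof -
      have "?C \<inter> T = E \<inter> T" by blast
      then have "?\<mu> ?C = ?\<mu> E" using E Cb by (intro cong) auto
      then show ?thesis using E Cb by (simp add: total_variation_nonneg[OF nn])
    qed
    also have "\<dots> \<le> (SUP C \<in> {C. compact C \<and> C \<subseteq> E}. total_variation ?\<mu> C)"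
      using C by (intro SUP_upper) auto
    finally show "total_variation ?\<mu> E \<le> (SUP C \<in> {C. compact C \<and> C \<subseteq> E}. total_variation ?\<mu> C)" .
  qed
  then show ?thesis using nn by (simp add: pos_measures_iff)
qed

lemma point_mass_pos: "point_mass (x :: 'a::t2_space) \<in> pos_measures"
  using discrete_measure_pos[of "{x}" "\<lambda>_. 1"] by (simp add: discrete_measure_def)

lemma integral_point_mass:
  fixes h :: "'a::t2_space \<Rightarrow> 'b::{banach, second_countable_topology}"
  assumes "h \<in> borel_measurable borel"
  shows "integral\<^sup>L (to_measure (point_mass x)) h = h x"
proof -
  have "nonneg_borel_measure (point_mass x)" using point_mass_pos[of x] by (simp add: pos_measures_iff)
  then have "to_measure (point_mass x) = return borel x"
    by (intro measure_eqI) (auto simp: emeasure_to_measure point_mass_def indicator_def)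
  then show ?thesis using assms by (simp add: integral_return)
qed

lemma integral_discrete_measure:
  fixes h :: "'a::t2_space \<Rightarrow> complex"
  assumes "finite T" "\<And>t. t \<in> T \<Longrightarrow> c t \<ge> 0" "h \<in> borel_measurable borel" "bounded (range h)"
  shows "integral\<^sup>L (to_measure (discrete_measure c T)) h = (\<Sum>t\<in>T. complex_of_real (c t) * h t)"
proof -
  have "nonneg_borel_measure (discrete_measure c T)" "nonneg_borel_measure (point_mass t)" for t :: 'a
    using discrete_measure_pos[OF assms(1,2)] point_mass_pos[of t] by (auto simp: pos_measures_iff)
  from integral_combination[OF assms(1) this assms(2) _ assms(3,4)] show ?thesis
    using assms(3) by (simp add: integral_point_mass discrete_measure_def)
qed

text \<open>
  Finitely supported measures are dense: moving the mass of each piece of a quantization to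
  its representative changes the integrals of the given functions very little.
\<close>

lemma discrete_approximation:
  fixes F :: "('a::t2_space \<Rightarrow> complex) set"
  assumes \<mu>: "nonneg_borel_measure \<mu>" and "finite F" "F \<subseteq> borel_measurable borel"
    and bdd: "\<forall>h\<in>F. bounded (range h)" and "e > 0"
  obtains T :: "'a set" and c where "finite T" "\<And>t. t \<in> T \<Longrightarrow> c t \<ge> 0"
    "\<And>h. h \<in> F \<Longrightarrow> cmod (integral\<^sup>L (to_measure \<mu>) h - (\<Sum>t\<in>T. complex_of_real (c t) * h t)) \<le> e"
proof -
  define m where "m = Re (\<mu> UNIV)"
  have m0: "m \<ge> 0" using \<mu> by (simp add: m_def nonneg_borel_measure_def)
  define d where "d = e / (m + 1)"
  have d: "d > 0" using m0 \<open>e > 0\<close> by (simp add: d_def)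
  obtain s where s: "finite (range s)" "\<And>h x. h \<in> F \<Longrightarrow> cmod (h x - h (s x)) \<le> d"
    and ms: "\<And>(M::'a measure) t. space M = UNIV \<Longrightarrow> F \<subseteq> borel_measurable M \<Longrightarrow> {x. s x = t} \<in> sets M"
    by (rule finite_quantization[OF \<open>finite F\<close> bdd d]) (rule that)
  have "cmod (integral\<^sup>L (to_measure \<mu>) h - (\<Sum>t\<in>range s. complex_of_real (Re (\<mu> {x. s x = t})) * h t)) \<le> e"
    if "h \<in> F" for h
  proof -
    have "cmod (integral\<^sup>L (to_measure \<mu>) h - (\<Sum>t\<in>range s. complex_of_real (Re (\<mu> {x. s x = t})) * h t)) \<le> d * m"
      using integral_quantized[OF finite_measure_to_measure[OF \<mu>], of s h d] s ms[of "to_measure \<mu>"] assms(3) bdd that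
      unfolding measure_to_measure[OF \<mu>] m_def by auto
    also have "\<dots> \<le> e" using m0 \<open>e > 0\<close> by (simp add: d_def field_simps)
    finally show ?thesis .
  qed
  then show thesis using that[of "range s" "\<lambda>t. Re (\<mu> {x. s x = t})"] s(1) \<mu>
    by (simp add: nonneg_borel_measure_def)
qed

section \<open>The cone topology\<close>

text \<open>
  Urysohn's lemma for the compact set \<open>C\<close> and the complement of a relatively compact neighbourhood
  of \<open>C\<close>.
\<close>

lemma compact_cutoff:
  fixes C :: "'a::t2_space set"
  assumes lc: "locally_compact_space (euclidean :: 'a topology)" and C: "compact C"
  obtains \<phi> :: "'a \<Rightarrow> real" where "continuous_on UNIV \<phi>" "\<And>x. 0 \<le> \<phi> x \<and> \<phi> x \<le> 1"
    "\<And>x. x \<in> C \<Longrightarrow> \<phi> x = 1" "compact (closure {x. \<phi> x \<noteq> 0})"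
proof -
  have H: "Hausdorff_space (euclidean :: 'a topology)"
    unfolding Hausdorff_space_def disjnt_def by (intro allI impI) (use hausdorff in fastforce)
  obtain U L where UL: "open U" "compact L" "C \<subseteq> U" "U \<subseteq> L"
    using lc C unfolding locally_compact_space_compact_closed_compact[OF disjI1[OF H]] by auto
  have "completely_regular_space (euclidean :: 'a topology)"
    by (rule locally_compact_regular_imp_completely_regular_space[OF lc disjI1[OF H]])
  moreover have "disjnt (- U) C" using UL(3) by (auto simp: disjnt_def)
  ultimately obtain \<phi> where \<phi>: "continuous_map euclidean (top_of_set {0..1::real}) \<phi>" "\<phi> ` (- U) \<subseteq> {0}" "\<phi> ` C \<subseteq> {1}"
    using Urysohn_completely_regular_compact_closed[of 0 "1::real" "euclidean :: 'a topology" C "- U"] UL(1) C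
    by (auto simp: disjnt_sym)
  show thesis
  proof (rule that)
    show "continuous_on UNIV \<phi>" using \<phi>(1) by (simp add: continuous_map_in_subtopology)
    show "0 \<le> \<phi> x \<and> \<phi> x \<le> 1" for x using \<phi>(1) by (auto simp: continuous_map_in_subtopology Pi_iff)
    show "\<phi> x = 1" if "x \<in> C" for x using \<phi>(3) that by auto
    have "{x. \<phi> x \<noteq> 0} \<subseteq> L" using \<phi>(2) UL(4) by auto
    then have "closure {x. \<phi> x \<noteq> 0} \<subseteq> L"
      using UL(2) by (intro closure_minimal compact_imp_closed)
    then show "compact (closure {x. \<phi> x \<noteq> 0})"
      using UL(2) compact_Int_closed[OF UL(2) closed_closure, of "{x. \<phi> x \<noteq> 0}"] by (simp add: Int_absorb1)
  qed
qed

lemma cone_test_functionsD: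
  assumes "h \<in> cone_test_functions"
  shows "continuous_on UNIV h" "bounded (range h)" "h \<in> borel_measurable borel"
proof -
  show c: "continuous_on UNIV h" using assms by (auto simp: cone_test_functions_def)
  then show "h \<in> borel_measurable borel" by (rule borel_measurable_continuous_onI)
  show "bounded (range h)"
  proof (cases "h = (\<lambda>x. 1)")
    case True
    then show ?thesis by simp
  next
    case False
    then have "compact (closure {x. h x \<noteq> 0})" using assms by (auto simp: cone_test_functions_def)
    then have "compact (h ` closure {x. h x \<noteq> 0})"
      using c by (intro compact_continuous_image) (auto intro: continuous_on_subset)
    then have "bounded (insert 0 (h ` closure {x. h x \<noteq> 0}))" by (simp add: compact_imp_bounded)
    moreover have "range h \<subseteq> insert 0 (h ` closure {x. h x \<noteq> 0})"
      using closure_subset[of "{x. h x \<noteq> 0}"] by auto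
    ultimately show ?thesis by (rule bounded_subset)
  qed
qed

lemma topspace_cone_topology[simp]: "topspace cone_topology = pos_measures"
proof -
  have "(\<lambda>x. 1) \<in> cone_test_functions" by (simp add: cone_test_functions_def)
  then show ?thesis
    unfolding cone_topology_def by (auto intro!: exI[of _ "\<lambda>x. 1"] exI[of _ UNIV])
qed

lemma continuous_map_integral_test:
  assumes "h \<in> cone_test_functions"
  shows "continuous_map cone_topology euclidean (\<lambda>\<mu>. integral\<^sup>L (to_measure \<mu>) h)"
  unfolding continuous_map_def
proof (intro conjI allI impI)
  fix U :: "real set" assume "openin euclidean U"
  then have "{\<mu> \<in> pos_measures. integral\<^sup>L (to_measure \<mu>) h \<in> U} \<in>
    {{\<mu> \<in> pos_measures. integral\<^sup>L (to_measure \<mu>) f \<in> U} | f U. f \<in> cone_test_functions \<and> open U}"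
    using assms by auto
  then show "openin cone_topology {\<mu> \<in> topspace cone_topology. integral\<^sup>L (to_measure \<mu>) h \<in> U}"
    unfolding topspace_cone_topology unfolding cone_topology_def by (rule topology_generated_by_Basis)
qed simp

text \<open>
  The basic neighbourhoods of the cone topology, by induction over the open sets that the sub-basis
  generates.
\<close>

lemma openin_cone_topologyD:
  assumes "openin cone_topology V" "\<mu> \<in> V"
  shows "\<exists>H d. finite H \<and> H \<subseteq> cone_test_functions \<and> d > 0 \<and>
           (\<forall>\<nu>\<in>pos_measures. (\<forall>h\<in>H. \<bar>integral\<^sup>L (to_measure \<nu>) h - integral\<^sup>L (to_measure \<mu>) h\<bar> < d) \<longrightarrow> \<nu> \<in> V)"
    (is "?N V")
proof -
  have "generate_topology_on {{\<mu> \<in> pos_measures. integral\<^sup>L (to_measure \<mu>) f \<in> U} | f U. f \<in> cone_test_functions \<and> open U} V"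
    using assms(1) unfolding cone_topology_def by (rule openin_topology_generated_by)
  then show ?thesis using assms(2)
  proof induct
    case Empty
    then show ?case by simp
  next
    case (Int A B)
    from Int(2) Int(5) obtain H1 d1 where
      1: "finite H1" "H1 \<subseteq> cone_test_functions" "d1 > 0"
        "\<And>\<nu>. \<nu> \<in> pos_measures \<Longrightarrow> \<forall>h\<in>H1. \<bar>integral\<^sup>L (to_measure \<nu>) h - integral\<^sup>L (to_measure \<mu>) h\<bar> < d1 \<Longrightarrow> \<nu> \<in> A"
      by blast
    from Int(4) Int(5) obtain H2 d2 where
      2: "finite H2" "H2 \<subseteq> cone_test_functions" "d2 > 0"
        "\<And>\<nu>. \<nu> \<in> pos_measures \<Longrightarrow> \<forall>h\<in>H2. \<bar>integral\<^sup>L (to_measure \<nu>) h - integral\<^sup>L (to_measure \<mu>) h\<bar> < d2 \<Longrightarrow> \<nu> \<in> B"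
      by blast
    show ?case
    proof (intro exI[of _ "H1 \<union> H2"] exI[of _ "min d1 d2"] conjI ballI impI)
      fix \<nu> :: "'a set \<Rightarrow> complex" assume \<nu>: "\<nu> \<in> pos_measures" "\<forall>h\<in>H1 \<union> H2. \<bar>integral\<^sup>L (to_measure \<nu>) h - integral\<^sup>L (to_measure \<mu>) h\<bar> < min d1 d2"
      show "\<nu> \<in> A \<inter> B" using 1(4)[OF \<nu>(1)] 2(4)[OF \<nu>(1)] \<nu>(2) by auto
    qed (use 1 2 in auto)
  next
    case (UN K)
    then obtain k where "k \<in> K" "\<mu> \<in> k" by blast
    from UN(2)[OF this] obtain H d where "finite H" "H \<subseteq> cone_test_functions" "d > 0"
        "\<forall>\<nu>\<in>pos_measures. (\<forall>h\<in>H. \<bar>integral\<^sup>L (to_measure \<nu>) h - integral\<^sup>L (to_measure \<mu>) h\<bar> < d) \<longrightarrow> \<nu> \<in> k" by blast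
    then show ?case using \<open>k \<in> K\<close> by (intro exI[of _ H] exI[of _ d]) blast
  next
    case (Basis S)
    then obtain f U where S: "S = {\<mu> \<in> pos_measures. integral\<^sup>L (to_measure \<mu>) f \<in> U}" and f: "f \<in> cone_test_functions" and U: "open U"
      by blast
    have "integral\<^sup>L (to_measure \<mu>) f \<in> U" using Basis(2) S by blast
    then obtain d where d: "d > 0" "\<And>y. dist y (integral\<^sup>L (to_measure \<mu>) f) < d \<Longrightarrow> y \<in> U"
      using U unfolding open_dist by blast
    show ?case
      by (intro exI[of _ "{f}"] exI[of _ d]) (use d f in \<open>auto simp: S dist_real_def\<close>)
  qed
qed

text \<open>
  Choose a compactly supported cut-off \<open>\<phi>\<close> that captures almost all of the mass of \<open>\<mu>\<close>. The functions
  \<open>f \<phi>\<close>, \<open>\<phi>\<close> and \<open>1\<close> are test functions, so near \<open>\<mu>\<close> the integral of \<open>f \<phi>\<close> changes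
  little and the mass \<open>\<integral>(1 - \<phi>)\<close> outside the cut-off stays small; this mass bounds the error of
  replacing \<open>f\<close> by \<open>f \<phi>\<close>.
\<close>

lemma cone_continuous_integral_nonneg:
  fixes f :: "'a::t2_space \<Rightarrow> real"
  assumes lc: "locally_compact_space (euclidean :: 'a topology)"
    and f: "continuous_on UNIV f" "\<And>x. 0 \<le> f x \<and> f x \<le> B"
  shows "continuous_map cone_topology euclidean (\<lambda>\<mu>. integral\<^sup>L (to_measure \<mu>) f)"
  unfolding continuous_map_atin limitin_canonical_iff
proof (intro ballI tendstoI)
  fix \<mu> :: "'a set \<Rightarrow> complex" and e :: real
  assume "\<mu> \<in> topspace cone_topology" and "e > 0"
  then have \<mu>: "\<mu> \<in> pos_measures" by simp
  have B: "B \<ge> 0" using f(2) order_trans by blast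
  \<comment> \<open>An error of \<open>B * d\<close> arises at \<open>\<mu>\<close> and at its neighbour; half of \<open>d\<close> is kept in reserve at \<open>\<mu>\<close> so that
    the mass outside the cut-off stays below \<open>d\<close> nearby.\<close>
  define d where "d = e / (3 * (B + 1))"
  have d: "d > 0" "3 * (B * d) < e"
    using B \<open>e > 0\<close> by (auto simp: d_def field_simps)
  obtain C where C: "compact C" "measure (to_measure \<mu>) (UNIV - C) \<le> d / 2"
    using pos_measures_tight[OF \<mu>, of "d / 2"] d(1) by auto
  obtain \<phi> :: "'a \<Rightarrow> real" where \<phi>: "continuous_on UNIV \<phi>" "\<And>x. 0 \<le> \<phi> x \<and> \<phi> x \<le> 1"
    "\<And>x. x \<in> C \<Longrightarrow> \<phi> x = 1" "compact (closure {x. \<phi> x \<noteq> 0})"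
    by (rule compact_cutoff[OF lc C(1)]) (rule that)
  let ?I = "\<lambda>\<nu> g. integral\<^sup>L (to_measure \<nu>) (g :: 'a \<Rightarrow> real)"
  let ?g = "\<lambda>x. f x * \<phi> x"
  have test: "\<phi> \<in> cone_test_functions" "(\<lambda>x. 1 :: real) \<in> (cone_test_functions :: ('a \<Rightarrow> real) set)" "?g \<in> cone_test_functions"
  proof -
    show "\<phi> \<in> cone_test_functions" "(\<lambda>x. 1 :: real) \<in> (cone_test_functions :: ('a \<Rightarrow> real) set)"
      using \<phi> by (auto simp: cone_test_functions_def)
    have "closure {x. ?g x \<noteq> 0} \<subseteq> closure {x. \<phi> x \<noteq> 0}" by (intro closure_mono) auto
    then have "compact (closure {x. ?g x \<noteq> 0})"
      using compact_Int_closed[OF \<phi>(4) closed_closure, of "{x. ?g x \<noteq> 0}"] by (simp add: Int_absorb1)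
    then show "?g \<in> cone_test_functions"
      using f \<phi> by (auto simp: cone_test_functions_def intro!: continuous_intros)
  qed
  have [measurable]: "f \<in> borel_measurable borel" "\<phi> \<in> borel_measurable borel"
    using f(1) \<phi>(1) by (auto intro: borel_measurable_continuous_onI)
  have int: "integrable (to_measure \<nu>) f" "integrable (to_measure \<nu>) \<phi>" "integrable (to_measure \<nu>) ?g"
    "integrable (to_measure \<nu>) (\<lambda>x. 1 :: real)" if "\<nu> \<in> pos_measures" for \<nu>
  proof -
    have nn: "nonneg_borel_measure \<nu>" using that by (simp add: pos_measures_iff)
    have "bounded (range f)" using f(2) by (auto simp: bounded_iff intro!: exI[of _ B])
    then show "integrable (to_measure \<nu>) f" by (intro integrable_to_measure nn) auto
    show "integrable (to_measure \<nu>) \<phi>" "integrable (to_measure \<nu>) ?g" "integrable (to_measure \<nu>) (\<lambda>x. 1 :: real)"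
      using cone_test_functionsD test by (auto intro!: integrable_to_measure nn)
  qed
  have cut: "\<bar>?I \<nu> f - ?I \<nu> ?g\<bar> \<le> B * (?I \<nu> (\<lambda>x. 1) - ?I \<nu> \<phi>)" if "\<nu> \<in> pos_measures" for \<nu>
  proof -
    note [simp] = int[OF that]
    have "\<bar>?I \<nu> f - ?I \<nu> ?g\<bar> = \<bar>\<integral>x. f x - f x * \<phi> x \<partial>to_measure \<nu>\<bar>" by simp
    also have "\<dots> \<le> (\<integral>x. \<bar>f x - f x * \<phi> x\<bar> \<partial>to_measure \<nu>)" by (rule integral_abs_bound)
    also have "\<dots> \<le> (\<integral>x. B * (1 - \<phi> x) \<partial>to_measure \<nu>)"
    proof (rule integral_mono)
      show "\<bar>f x - f x * \<phi> x\<bar> \<le> B * (1 - \<phi> x)" for x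
      proof -
        have "\<bar>f x - f x * \<phi> x\<bar> = f x * (1 - \<phi> x)"
          using f(2)[of x] \<phi>(2)[of x] mult_left_mono[of "\<phi> x" 1 "f x"] by (simp add: right_diff_distrib)
        also have "\<dots> \<le> B * (1 - \<phi> x)" using f(2)[of x] \<phi>(2)[of x] by (intro mult_right_mono) auto
        finally show ?thesis .
      qed
    qed auto
    also have "\<dots> = B * (?I \<nu> (\<lambda>x. 1) - ?I \<nu> \<phi>)" by simp
    finally show ?thesis .
  qed
  have tail: "?I \<mu> (\<lambda>x. 1) - ?I \<mu> \<phi> \<le> d / 2"
  proof -
    note [simp] = int[OF \<mu>]
    interpret finite_measure "to_measure \<mu>"
      using \<mu> by (intro finite_measure_to_measure) (simp add: pos_measures_iff)
    have Cb: "UNIV - C \<in> sets borel" using borel_closed[OF compact_imp_closed[OF C(1)]] by auto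
    have "?I \<mu> (\<lambda>x. 1) - ?I \<mu> \<phi> = (\<integral>x. 1 - \<phi> x \<partial>to_measure \<mu>)" by simp
    also have "\<dots> \<le> (\<integral>x. indicator (UNIV - C) x \<partial>to_measure \<mu>)"
    proof (rule integral_mono)
      show "integrable (to_measure \<mu>) (\<lambda>x. 1 - \<phi> x)" by simp
      show "integrable (to_measure \<mu>) (indicator (UNIV - C) :: 'a \<Rightarrow> real)"
        using Cb by (intro integrable_real_indicator) (simp_all add: less_top[symmetric])
      show "1 - \<phi> x \<le> indicator (UNIV - C) x" for x
        using \<phi>(2,3)[of x] by (cases "x \<in> C") auto
    qed
    also have "\<dots> \<le> d / 2" using C(2) by simp
    finally show ?thesis .
  qed
  have lim: "((\<lambda>\<nu>. ?I \<nu> h) \<longlongrightarrow> ?I \<mu> h) (atin cone_topology \<mu>)" if "h \<in> cone_test_functions" for h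
    using continuous_map_integral_test[OF that] \<mu> unfolding continuous_map_atin by simp
  have pos: "\<forall>\<^sub>F \<nu> in atin cone_topology \<mu>. \<nu> \<in> pos_measures"
    using openin_topspace[of cone_topology] \<mu> unfolding eventually_atin by auto
  have "((\<lambda>\<nu>. ?I \<nu> (\<lambda>x. 1) - ?I \<nu> \<phi>) \<longlongrightarrow> ?I \<mu> (\<lambda>x. 1) - ?I \<mu> \<phi>) (atin cone_topology \<mu>)"
    by (intro tendsto_diff lim test)
  then have 1: "\<forall>\<^sub>F \<nu> in atin cone_topology \<mu>. ?I \<nu> (\<lambda>x. 1) - ?I \<nu> \<phi> < d"
    by (rule order_tendstoD(2)) (use tail d(1) in linarith)
  have "e - 2 * (B * d) > 0" using d(2) mult_nonneg_nonneg[OF B less_imp_le[OF d(1)]] by linarith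
  with lim[OF test(3)] have 2: "\<forall>\<^sub>F \<nu> in atin cone_topology \<mu>. dist (?I \<nu> ?g) (?I \<mu> ?g) < e - 2 * (B * d)"
    by (rule tendstoD)
  show "\<forall>\<^sub>F \<nu> in atin cone_topology \<mu>. dist (?I \<nu> f) (?I \<mu> f) < e"
    using pos 1 2
  proof eventually_elim
    case (elim \<nu>)
    have a: "\<bar>?I \<nu> f - ?I \<nu> ?g\<bar> \<le> B * d"
      using cut[OF elim(1)] mult_left_mono[OF less_imp_le[OF elim(2)] B] by linarith
    have "?I \<mu> (\<lambda>x. 1) - ?I \<mu> \<phi> \<le> d" using tail d(1) by linarith
    from cut[OF \<mu>] mult_left_mono[OF this B] have "\<bar>?I \<mu> f - ?I \<mu> ?g\<bar> \<le> B * d" by linarith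
    with a elim(3) show ?case unfolding dist_real_def by linarith
  qed
qed

lemma bcontfunD:
  fixes f :: "'a::topological_space \<Rightarrow> complex"
  assumes "f \<in> bcontfun"
  shows "f \<in> borel_measurable borel" "bounded (range f)" "continuous_on UNIV f"
  using assms by (auto simp: bcontfun_def intro: borel_measurable_continuous_onI)

text \<open>
  A complex function is a combination of the non-negative functions \<open>Re f + B\<close> and \<open>Im f + B\<close> and of
  constants.
\<close>

lemma cone_continuous_integral:
  fixes f :: "'a::t2_space \<Rightarrow> complex"
  assumes lc: "locally_compact_space (euclidean :: 'a topology)" and f: "f \<in> bcontfun"
  shows "continuous_map cone_topology euclidean (\<lambda>\<mu>. integral\<^sup>L (to_measure \<mu>) f)"
proof -
  note [measurable] = bcontfunD(1)[OF f]
  have c: "continuous_on UNIV f" using f by (rule bcontfunD)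
  obtain B where B: "\<And>x. cmod (f x) \<le> B"
    using bcontfunD(2)[OF f] by (auto simp: bounded_iff)
  have B': "\<bar>Re (f x)\<bar> \<le> B" "\<bar>Im (f x)\<bar> \<le> B" for x
    using order_trans[OF abs_Re_le_cmod B] order_trans[OF abs_Im_le_cmod B] by auto
  let ?I = "\<lambda>\<nu> g. integral\<^sup>L (to_measure \<nu>) (g :: 'a \<Rightarrow> real)"
  define \<Psi> where "\<Psi> \<mu> = complex_of_real (?I \<mu> (\<lambda>x. Re (f x) + B) - B * ?I \<mu> (\<lambda>x. 1)) +
      \<i> * complex_of_real (?I \<mu> (\<lambda>x. Im (f x) + B) - B * ?I \<mu> (\<lambda>x. 1))" for \<mu>
  have eq: "integral\<^sup>L (to_measure \<mu>) f = \<Psi> \<mu>" if "\<mu> \<in> pos_measures" for \<mu>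
  proof -
    have nn: "nonneg_borel_measure \<mu>" using that by (simp add: pos_measures_iff)
    have "integrable (to_measure \<mu>) f" by (intro integrable_to_measure nn bcontfunD f)
    moreover have "integrable (to_measure \<mu>) (\<lambda>x. c)" for c :: real by (intro integrable_to_measure nn) auto
    ultimately show ?thesis by (simp add: \<Psi>_def complex_eq_iff)
  qed
  have lim: "((\<lambda>\<nu>. ?I \<nu> h) \<longlongrightarrow> ?I \<mu> h) (atin cone_topology \<mu>)"
    if "continuous_on UNIV h" "\<And>x. 0 \<le> h x \<and> h x \<le> D" "\<mu> \<in> pos_measures" for h D \<mu>
    using cone_continuous_integral_nonneg[OF lc that(1,2)] that(3) unfolding continuous_map_atin by simp
  have "continuous_map cone_topology euclidean \<Psi>"
    unfolding continuous_map_atin limitin_canonical_iff topspace_cone_topology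
  proof
    fix \<mu> :: "'a set \<Rightarrow> complex" assume \<mu>: "\<mu> \<in> pos_measures"
    have 1: "((\<lambda>\<nu>. ?I \<nu> (\<lambda>x. Re (f x) + B)) \<longlongrightarrow> ?I \<mu> (\<lambda>x. Re (f x) + B)) (atin cone_topology \<mu>)"
    proof (rule lim[OF _ _ \<mu>])
      show "0 \<le> Re (f x) + B \<and> Re (f x) + B \<le> 2 * B" for x using B'[of x] by linarith
    qed (intro continuous_intros c)
    have 2: "((\<lambda>\<nu>. ?I \<nu> (\<lambda>x. Im (f x) + B)) \<longlongrightarrow> ?I \<mu> (\<lambda>x. Im (f x) + B)) (atin cone_topology \<mu>)"
    proof (rule lim[OF _ _ \<mu>])
      show "0 \<le> Im (f x) + B \<and> Im (f x) + B \<le> 2 * B" for x using B'[of x] by linarith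
    qed (intro continuous_intros c)
    have 3: "((\<lambda>\<nu>. ?I \<nu> (\<lambda>x. 1)) \<longlongrightarrow> ?I \<mu> (\<lambda>x. 1)) (atin cone_topology \<mu>)"
      by (rule lim[OF _ _ \<mu>, of _ 1]) auto
    show "(\<Psi> \<longlongrightarrow> \<Psi> \<mu>) (atin cone_topology \<mu>)"
      unfolding \<Psi>_def by (intro tendsto_intros 1 2 3)
  qed
  then show ?thesis
    by (rule continuous_map_eq) (simp add: eq)
qed

text \<open>
  Continuity of \<open>\<Phi>\<close> at \<open>\<mu>\<close> involves finitely many test functions. A finitely supported measure that agrees with
  \<open>\<mu>\<close> up to a small error on these and on \<open>\<phi>\<close> links \<open>\<Phi> \<mu>\<close> to the integral of \<open>\<phi>\<close>.
\<close>

lemma cone_continuous_linear_eq_integral: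
  fixes \<Phi> :: "('a::t2_space set \<Rightarrow> complex) \<Rightarrow> complex"
  assumes \<Phi>: "continuous_map cone_topology euclidean \<Phi>"
    and lin: "\<And>T c. finite T \<Longrightarrow> (\<And>t. t \<in> T \<Longrightarrow> c t \<ge> 0) \<Longrightarrow>
        \<Phi> (discrete_measure c T) = (\<Sum>t\<in>T. complex_of_real (c t) * \<phi> t)"
    and \<phi>: "\<phi> \<in> borel_measurable borel" "bounded (range \<phi>)"
    and \<mu>: "\<mu> \<in> pos_measures"
  shows "\<Phi> \<mu> = integral\<^sup>L (to_measure \<mu>) \<phi>"
proof -
  have nn: "nonneg_borel_measure \<mu>" using \<mu> by (simp add: pos_measures_iff)
  have "cmod (\<Phi> \<mu> - integral\<^sup>L (to_measure \<mu>) \<phi>) \<le> 0 + e" if "e > 0" for e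
  proof -
    define V where "V = {\<nu> \<in> topspace cone_topology. \<Phi> \<nu> \<in> ball (\<Phi> \<mu>) (e / 2)}"
    have V: "openin cone_topology V" "\<mu> \<in> V"
      using openin_continuous_map_preimage[OF \<Phi>, of "ball (\<Phi> \<mu>) (e / 2)"] \<mu> \<open>e > 0\<close> by (simp_all add: V_def)
    obtain H d where H: "finite H" "H \<subseteq> cone_test_functions" "d > 0"
      and nbhd: "\<forall>\<nu>\<in>pos_measures. (\<forall>h\<in>H. \<bar>integral\<^sup>L (to_measure \<nu>) h - integral\<^sup>L (to_measure \<mu>) h\<bar> < d) \<longrightarrow> \<nu> \<in> V"
      using openin_cone_topologyD[OF V] by blast
    define F where "F = insert \<phi> ((\<lambda>h x. complex_of_real (h x)) ` H)"
    define r where "r = min (e / 2) (d / 2)"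
    have test: "(\<lambda>x. complex_of_real (h x)) \<in> borel_measurable borel \<and> bounded (range (\<lambda>x. complex_of_real (h x)))"
      if "h \<in> H" for h
    proof -
      have h: "h \<in> cone_test_functions" using that H(2) by blast
      note [measurable] = cone_test_functionsD(3)[OF h]
      show ?thesis using cone_test_functionsD(2)[OF h] by (simp add: bounded_iff)
    qed
    have F: "finite F" "F \<subseteq> borel_measurable borel" "\<forall>h\<in>F. bounded (range h)" "r > 0"
      unfolding F_def r_def using H(1,3) \<phi> \<open>e > 0\<close> test by (simp_all add: image_subset_iff)
    obtain T c where T: "finite T" "\<And>t. t \<in> T \<Longrightarrow> c t \<ge> 0"
      and app: "\<And>h. h \<in> F \<Longrightarrow> cmod (integral\<^sup>L (to_measure \<mu>) h - (\<Sum>t\<in>T. complex_of_real (c t) * h t)) \<le> r"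
      by (rule discrete_approximation[OF nn F]) (rule that)
    let ?\<nu> = "discrete_measure c T"
    have \<nu>: "?\<nu> \<in> pos_measures" using T by (rule discrete_measure_pos)
    have "\<bar>integral\<^sup>L (to_measure ?\<nu>) h - integral\<^sup>L (to_measure \<mu>) h\<bar> < d" if "h \<in> H" for h
    proof -
      have hF: "(\<lambda>x. complex_of_real (h x)) \<in> F" using that by (simp add: F_def)
      have "integral\<^sup>L (to_measure ?\<nu>) (\<lambda>x. complex_of_real (h x)) = (\<Sum>t\<in>T. complex_of_real (c t) * complex_of_real (h t))"
        using F hF by (intro integral_discrete_measure T) auto
      with app[OF hF] have "cmod (complex_of_real (integral\<^sup>L (to_measure \<mu>) h - integral\<^sup>L (to_measure ?\<nu>) h)) \<le> r"
        by simp
      then show ?thesis using \<open>d > 0\<close> unfolding norm_of_real r_def by linarith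
    qed
    then have "?\<nu> \<in> V" using nbhd \<nu> by blast
    then have 1: "cmod (\<Phi> \<mu> - \<Phi> ?\<nu>) \<le> e / 2" by (simp add: V_def dist_norm)
    have 2: "cmod (integral\<^sup>L (to_measure \<mu>) \<phi> - \<Phi> ?\<nu>) \<le> e / 2"
      using app[of \<phi>] lin[OF T] by (simp add: F_def r_def)
    have "\<Phi> \<mu> - integral\<^sup>L (to_measure \<mu>) \<phi> = (\<Phi> \<mu> - \<Phi> ?\<nu>) - (integral\<^sup>L (to_measure \<mu>) \<phi> - \<Phi> ?\<nu>)" by simp
    then show ?thesis using norm_triangle_ineq4[of "\<Phi> \<mu> - \<Phi> ?\<nu>" "integral\<^sup>L (to_measure \<mu>) \<phi> - \<Phi> ?\<nu>"] 1 2 by simp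
  qed
  then have "cmod (\<Phi> \<mu> - integral\<^sup>L (to_measure \<mu>) \<phi>) \<le> 0" by (rule field_le_epsilon)
  then show ?thesis by simp
qed

lemma continuous_map_point_mass:
  "continuous_map (euclidean :: 'a::t2_space topology) cone_topology point_mass"
  unfolding cone_topology_def
proof (rule continuous_on_generated_topo)
  fix V :: "('a set \<Rightarrow> complex) set"
  assume "V \<in> {{\<mu> \<in> pos_measures. integral\<^sup>L (to_measure \<mu>) f \<in> U} | f U. f \<in> cone_test_functions \<and> open U}"
  then obtain f :: "'a \<Rightarrow> real" and U where V: "V = {\<mu> \<in> pos_measures. integral\<^sup>L (to_measure \<mu>) f \<in> U}"
    and f: "f \<in> cone_test_functions" and U: "open U" by blast
  have "point_mass -` V = f -` U"
    using cone_test_functionsD(3)[OF f] by (auto simp: V point_mass_pos integral_point_mass)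
  then show "openin euclidean (point_mass -` V \<inter> topspace euclidean)"
    using U cone_test_functionsD(1)[OF f] by (simp add: open_vimage)
next
  show "point_mass ` topspace euclidean \<subseteq>
    \<Union> {{\<mu> \<in> pos_measures. integral\<^sup>L (to_measure \<mu>) f \<in> U} | f U. f \<in> cone_test_functions \<and> open U}"
    unfolding topspace_cone_topology[unfolded cone_topology_def topology_generated_by_topspace]
    using point_mass_pos by auto
qed

section \<open>Translations and introversion\<close>

lemma integral_diff_le:
  fixes f g :: "'a::topological_space \<Rightarrow> complex"
  assumes \<nu>: "nonneg_borel_measure \<nu>" and f: "f \<in> bcontfun" and g: "g \<in> bcontfun"
    and d: "\<And>x. cmod (f x - g x) \<le> d"
  shows "cmod (integral\<^sup>L (to_measure \<nu>) f - integral\<^sup>L (to_measure \<nu>) g) \<le> d * Re (\<nu> UNIV)"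
proof -
  interpret finite_measure "to_measure \<nu>" by (rule finite_measure_to_measure[OF \<nu>])
  have i: "integrable (to_measure \<nu>) f" "integrable (to_measure \<nu>) g"
    by (intro integrable_to_measure \<nu> bcontfunD f g)+
  then have "integral\<^sup>L (to_measure \<nu>) f - integral\<^sup>L (to_measure \<nu>) g = (\<integral>x. f x - g x \<partial>to_measure \<nu>)" by simp
  also have "cmod \<dots> \<le> (\<integral>x. d \<partial>to_measure \<nu>)"
    using i by (intro order_trans[OF integral_norm_bound integral_mono]) (auto simp: d)
  finally show ?thesis by (simp add: measure_to_measure[OF \<nu>] mult.commute)
qed

lemma bcontfun_combination:
  fixes f g :: "'a::topological_space \<Rightarrow> complex"
  assumes "f \<in> bcontfun" "g \<in> bcontfun"
  shows "(\<lambda>x. a * f x + b * g x) \<in> bcontfun"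
proof -
  obtain B where B: "\<And>x. cmod (f x) \<le> B" using bcontfunD(2)[OF assms(1)] by (auto simp: bounded_iff)
  obtain D where D: "\<And>x. cmod (g x) \<le> D" using bcontfunD(2)[OF assms(2)] by (auto simp: bounded_iff)
  show ?thesis
  proof (rule bcontfun_normI)
    show "continuous_on UNIV (\<lambda>x. a * f x + b * g x)"
      by (intro continuous_intros bcontfunD assms)
    show "cmod (a * f x + b * g x) \<le> cmod a * B + cmod b * D" for x
      by (intro norm_triangle_le add_mono) (simp_all add: norm_mult B D mult_left_mono)
  qed
qed

text \<open>
  Left and right translates are the rows and columns of one matrix.
\<close>

lemma Ltrans_eq_Rtrans: "Ltrans conv x f y = Rtrans conv y f x"
  by (simp add: Ltrans_def Rtrans_def)

context semitopological_semihypergroup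
begin

text \<open>
  Reversing the multiplication exchanges left and right translates, and \<open>T\<^sub>\<mu>\<close> and \<open>U\<^sub>\<mu>\<close>. Every result about
  the left side thus has a mirror image.
\<close>

lemma opposite: "semitopological_semihypergroup (\<lambda>\<mu> \<nu>. \<nu> \<star> \<mu>)"
proof (rule semitopological_semihypergroup.intro)
  have "continuous_map (euclidean :: ('a \<times> 'a) topology) euclidean (\<lambda>z. (snd z, fst z))"
    by (auto intro!: continuous_intros)
  from continuous_map_compose[OF this support_continuous]
  show "continuous_map (euclidean :: ('a \<times> 'a) topology) michael_topology
      (\<lambda>(x, y). msupport (point_mass y \<star> point_mass x))"
    by (simp add: o_def case_prod_unfold)
  show "prob_space (to_measure (point_mass y \<star> point_mass x))" for x y by (rule conv_prob)
qed (simp_all add: locally_compact conv_closed conv_assoc conv_add_left conv_add_right conv_scale_left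
    conv_scale_right conv_pos conv_continuous_left conv_continuous_right conv_compact_support)

lemma point_conv_pos: "point_mass x \<star> point_mass y \<in> pos_measures"
  by (intro conv_pos point_mass_pos)

lemma pos_nonneg: "\<mu> \<in> pos_measures \<Longrightarrow> nonneg_borel_measure \<mu>"
  and pos_regular: "\<mu> \<in> pos_measures \<Longrightarrow> \<mu> \<in> regular_measures"
  by (simp_all add: pos_measures_iff) (simp add: pos_measures_def flip: pos_measures_iff)

lemma Re_point_conv_UNIV: "Re ((point_mass x \<star> point_mass y) UNIV) = 1"
proof -
  interpret prob_space "to_measure (point_mass x \<star> point_mass y)" by (rule conv_prob)
  show ?thesis using prob_space measure_to_measure[OF pos_nonneg[OF point_conv_pos[of x y]], of UNIV] by simp
qed

lemma conv_discrete:
  assumes \<omega>: "\<omega> \<in> pos_measures" and "finite T" "\<And>t. t \<in> T \<Longrightarrow> c t \<ge> 0"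
  shows "\<omega> \<star> discrete_measure c T = (\<lambda>E. \<Sum>t\<in>T. complex_of_real (c t) * (\<omega> \<star> point_mass t) E)"
  using assms(2,3)
proof (induction T rule: finite_induct)
  case empty
  \<comment> \<open>The zero measure is \<open>0\<close> times an arbitrary point mass.\<close>
  show ?case
    using conv_scale_right[OF pos_regular[OF \<omega>] pos_regular[OF point_mass_pos[of undefined]], of 0]
    by (simp add: discrete_measure_def)
next
  case (insert t T)
  have T: "discrete_measure c T \<in> pos_measures" "discrete_measure c {t} \<in> pos_measures"
    using insert by (auto intro!: discrete_measure_pos)
  have t: "discrete_measure c {t} = (\<lambda>E. complex_of_real (c t) * point_mass t E)"
    by (simp add: discrete_measure_def)
  have "discrete_measure c (insert t T) = (\<lambda>E. complex_of_real (c t) * point_mass t E + discrete_measure c T E)"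
    using insert(1,2) by (simp add: discrete_measure_def)
  moreover have "\<omega> \<star> (\<lambda>E. complex_of_real (c t) * point_mass t E + discrete_measure c T E) =
      (\<lambda>E. (\<omega> \<star> (\<lambda>E. complex_of_real (c t) * point_mass t E)) E + (\<omega> \<star> discrete_measure c T) E)"
    by (rule conv_add_right) (use T \<omega> pos_regular in \<open>auto simp: t\<close>)
  moreover have "\<omega> \<star> (\<lambda>E. complex_of_real (c t) * point_mass t E) = (\<lambda>E. complex_of_real (c t) * (\<omega> \<star> point_mass t) E)"
    by (intro conv_scale_right pos_regular \<omega> point_mass_pos)
  ultimately show ?case using insert by simp
qed

lemma Ltrans_bound:
  assumes "f \<in> bcontfun" "\<And>x. cmod (f x) \<le> B"
  shows "cmod (Ltrans conv x f y) \<le> B"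
  using integral_diff_le[OF pos_nonneg[OF point_conv_pos] assms(1) const_bcontfun[of 0], of B x y] assms(2)
  by (simp add: Ltrans_def Re_point_conv_UNIV)

text \<open>
  The translate is the composition of the point mass embedding, convolution with a fixed point mass and
  integration, all of them continuous for the cone topology.
\<close>

lemma Ltrans_bcontfun:
  assumes f: "f \<in> bcontfun"
  shows "Ltrans conv x f \<in> bcontfun"
proof -
  obtain B where B: "\<And>x. cmod (f x) \<le> B" using bcontfunD(2)[OF f] by (auto simp: bounded_iff)
  have "continuous_on UNIV (Ltrans conv x f)"
    using continuous_map_compose[OF continuous_map_compose[OF continuous_map_point_mass
          conv_continuous_right[OF point_mass_pos[of x]]] cone_continuous_integral[OF locally_compact f]]
    by (simp add: o_def Ltrans_def)
  then show ?thesis by (rule bcontfun_normI) (rule Ltrans_bound[OF f B])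
qed

lemma Ltrans_diff_le:
  assumes "f \<in> bcontfun" "g \<in> bcontfun" "\<And>x. cmod (f x - g x) \<le> d"
  shows "cmod (Ltrans conv x f y - Ltrans conv x g y) \<le> d"
  using integral_diff_le[OF pos_nonneg[OF point_conv_pos] assms, of x y]
  by (simp add: Ltrans_def Re_point_conv_UNIV)

lemma Ltrans_combination:
  assumes "f \<in> bcontfun" "g \<in> bcontfun"
  shows "Ltrans conv x (\<lambda>z. a * f z + b * g z) = (\<lambda>y. a * Ltrans conv x f y + b * Ltrans conv x g y)"
proof
  fix y
  have "integrable (to_measure (point_mass x \<star> point_mass y)) f"
    "integrable (to_measure (point_mass x \<star> point_mass y)) g"
    by (intro integrable_to_measure pos_nonneg point_conv_pos bcontfunD assms)+
  then show "Ltrans conv x (\<lambda>z. a * f z + b * g z) y = a * Ltrans conv x f y + b * Ltrans conv x g y"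
    by (simp add: Ltrans_def)
qed

text \<open>
  This is the substitute for Fubini's theorem. The axioms do not express the convolution of two
  measures as an integral over convolutions of point masses; this follows from separate continuity
  and linearity.
\<close>

lemma integral_conv_point_left:
  assumes f: "f \<in> bcontfun" and \<nu>: "\<nu> \<in> pos_measures"
  shows "integral\<^sup>L (to_measure (point_mass x \<star> \<nu>)) f = integral\<^sup>L (to_measure \<nu>) (Ltrans conv x f)"
proof (rule cone_continuous_linear_eq_integral[OF _ _ _ _ \<nu>])
  show "continuous_map cone_topology euclidean (\<lambda>\<nu>. integral\<^sup>L (to_measure (point_mass x \<star> \<nu>)) f)"
    using continuous_map_compose[OF conv_continuous_right[OF point_mass_pos[of x]] cone_continuous_integral[OF locally_compact f]]
    by (simp add: o_def)
  show "Ltrans conv x f \<in> borel_measurable borel" "bounded (range (Ltrans conv x f))"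
    using Ltrans_bcontfun[OF f] by (auto dest: bcontfunD)
  fix T and c :: "'a \<Rightarrow> real" assume T: "finite T" "\<And>t. t \<in> T \<Longrightarrow> c t \<ge> 0"
  show "integral\<^sup>L (to_measure (point_mass x \<star> discrete_measure c T)) f =
      (\<Sum>t\<in>T. complex_of_real (c t) * Ltrans conv x f t)"
    unfolding Ltrans_def
    by (rule integral_combination[OF T(1) _ _ T(2) conv_discrete[OF point_mass_pos T]])
      (use f T in \<open>auto intro!: pos_nonneg conv_pos point_mass_pos discrete_measure_pos dest: bcontfunD\<close>)
qed

lemma opposite_simps:
  "Ltrans (\<lambda>\<mu> \<nu>. \<nu> \<star> \<mu>) = Rtrans conv" "Rtrans (\<lambda>\<mu> \<nu>. \<nu> \<star> \<mu>) = Ltrans conv"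
  "AP (\<lambda>\<mu> \<nu>. \<nu> \<star> \<mu>) = AP conv" "T_op (\<lambda>\<mu> \<nu>. \<nu> \<star> \<mu>) = U_op conv"
proof -
  show *: "Ltrans (\<lambda>\<mu> \<nu>. \<nu> \<star> \<mu>) = Rtrans conv" "Rtrans (\<lambda>\<mu> \<nu>. \<nu> \<star> \<mu>) = Ltrans conv"
    by (intro ext, simp add: Ltrans_def Rtrans_def)+
  show "AP (\<lambda>\<mu> \<nu>. \<nu> \<star> \<mu>) = AP conv" "T_op (\<lambda>\<mu> \<nu>. \<nu> \<star> \<mu>) = U_op conv"
    unfolding AP_def AP_l_def AP_r_def T_op_def U_op_def * by auto
qed

lemmas Rtrans_bcontfun = semitopological_semihypergroup.Ltrans_bcontfun[OF opposite, unfolded opposite_simps]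

lemmas integral_conv_point_right =
  semitopological_semihypergroup.integral_conv_point_left[OF opposite, unfolded opposite_simps]

text \<open>
  Associativity: both sides integrate \<open>f\<close> over \<open>x * y * z\<close>.
\<close>

lemma Ltrans_Ltrans:
  assumes f: "f \<in> bcontfun"
  shows "Ltrans conv y (Ltrans conv x f) z = integral\<^sup>L (to_measure (point_mass x \<star> point_mass y)) (Rtrans conv z f)"
proof -
  have "Ltrans conv y (Ltrans conv x f) z = integral\<^sup>L (to_measure (point_mass y \<star> point_mass z)) (Ltrans conv x f)"
    by (simp add: Ltrans_def)
  also have "\<dots> = integral\<^sup>L (to_measure (point_mass x \<star> (point_mass y \<star> point_mass z))) f"
    by (rule integral_conv_point_left[OF f point_conv_pos, symmetric])
  also have "point_mass x \<star> (point_mass y \<star> point_mass z) = (point_mass x \<star> point_mass y) \<star> point_mass z"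
    by (intro conv_assoc[symmetric] pos_regular point_mass_pos)
  also have "integral\<^sup>L (to_measure \<dots>) f = integral\<^sup>L (to_measure (point_mass x \<star> point_mass y)) (Rtrans conv z f)"
    by (rule integral_conv_point_right[OF f point_conv_pos])
  finally show ?thesis .
qed

lemma Rtrans_Ltrans:
  assumes f: "f \<in> bcontfun"
  shows "Rtrans conv z (Ltrans conv x f) = Ltrans conv x (Rtrans conv z f)"
proof
  fix y
  have "Rtrans conv z (Ltrans conv x f) y = Ltrans conv y (Ltrans conv x f) z" by (simp add: Ltrans_eq_Rtrans)
  also have "\<dots> = Ltrans conv x (Rtrans conv z f) y" using Ltrans_Ltrans[OF f] by (simp add: Ltrans_def)
  finally show "Rtrans conv z (Ltrans conv x f) y = Ltrans conv x (Rtrans conv z f) y" .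
qed

lemma totally_bounded_translates_iff:
  assumes f: "f \<in> bcontfun"
  shows "totally_bounded_family (range (\<lambda>x. Ltrans conv x f)) \<longleftrightarrow> totally_bounded_family (range (\<lambda>x. Rtrans conv x f))"
proof -
  have L: "(\<lambda>x. Ltrans conv x f) = (\<lambda>x y. Rtrans conv y f x)" and R: "(\<lambda>x. Rtrans conv x f) = (\<lambda>x y. Ltrans conv y f x)"
    by (intro ext, simp add: Ltrans_eq_Rtrans)+
  have b: "bounded (range (Ltrans conv x f))" "bounded (range (Rtrans conv x f))" for x
    using bcontfunD(2) Ltrans_bcontfun[OF f] Rtrans_bcontfun[OF f] by blast+
  show ?thesis
    using totally_bounded_family_transpose[of "\<lambda>x. Ltrans conv x f", OF _ b(1), folded R]
      totally_bounded_family_transpose[of "\<lambda>x. Rtrans conv x f", OF _ b(2), folded L]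
    by blast
qed

lemma AP_iff_Ltrans:
  "f \<in> AP conv \<longleftrightarrow> f \<in> bcontfun \<and> totally_bounded_family (range (\<lambda>x. Ltrans conv x f))"
proof (cases "f \<in> bcontfun")
  case True
  have "{Ltrans conv x f | x. True} = range (\<lambda>x. Ltrans conv x f)" "{Rtrans conv x f | x. True} = range (\<lambda>x. Rtrans conv x f)"
    by auto
  then show ?thesis
    using True relatively_compact_in_C_iff[of "\<lambda>x. Ltrans conv x f", OF Ltrans_bcontfun[OF True]]
      relatively_compact_in_C_iff[of "\<lambda>x. Rtrans conv x f", OF Rtrans_bcontfun[OF True]]
      totally_bounded_translates_iff[OF True]
    by (simp add: AP_def AP_l_def AP_r_def)
qed (simp add: AP_def AP_l_def)

lemma AP_iff_Rtrans:
  "f \<in> AP conv \<longleftrightarrow> f \<in> bcontfun \<and> totally_bounded_family (range (\<lambda>x. Rtrans conv x f))"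
  using AP_iff_Ltrans totally_bounded_translates_iff by blast

lemma AP_bcontfun: "f \<in> AP conv \<Longrightarrow> f \<in> bcontfun"
  by (simp add: AP_iff_Ltrans)

lemma AP_combination:
  assumes "f \<in> AP conv" "g \<in> AP conv"
  shows "(\<lambda>x. a * f x + b * g x) \<in> AP conv"
  using assms unfolding AP_iff_Ltrans
  by (simp add: bcontfun_combination Ltrans_combination totally_bounded_family_combination)

text \<open>
  The right translates \<open>R\<^sub>z L\<^sub>x f = L\<^sub>x R\<^sub>z f\<close> form the image of a totally bounded family under the contraction
  \<open>L\<^sub>x\<close>.
\<close>

lemma AP_Ltrans:
  assumes "f \<in> AP conv"
  shows "Ltrans conv x f \<in> AP conv"
proof -
  have f: "f \<in> bcontfun" and tb: "totally_bounded_family (range (\<lambda>z. Rtrans conv z f))"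
    using assms by (simp_all add: AP_iff_Rtrans)
  have "totally_bounded_family (range (\<lambda>z. Ltrans conv x (Rtrans conv z f)))"
  proof (rule totally_bounded_family_image[OF tb, of _ 1])
    show "cmod (Ltrans conv x (Rtrans conv z f) y - Ltrans conv x (Rtrans conv z' f) y) \<le> 1 * d"
      if "\<And>y. cmod (Rtrans conv z f y - Rtrans conv z' f y) \<le> d" for z z' d y
      using Ltrans_diff_le[OF Rtrans_bcontfun[OF f] Rtrans_bcontfun[OF f] that] by simp
  qed
  then show ?thesis
    unfolding AP_iff_Rtrans using Ltrans_bcontfun[OF f] by (simp add: Rtrans_Ltrans[OF f])
qed

lemma AP_zero: "(\<lambda>x. 0) \<in> AP conv"
proof -
  have "Ltrans conv x (\<lambda>x. 0) = (\<lambda>x. 0)" for x by (simp add: Ltrans_def)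
  then show ?thesis
    using const_bcontfun[of "0 :: complex"]
    by (auto simp: AP_iff_Ltrans totally_bounded_family_def intro!: exI[of _ "{\<lambda>x. 0}"])
qed

lemma dual_combination:
  assumes "\<mu> \<in> dual_space (AP conv)" "f \<in> AP conv" "g \<in> AP conv"
  shows "\<mu> (\<lambda>x. a * f x + b * g x) = a * \<mu> f + b * \<mu> g"
proof -
  have "(\<lambda>x. a * f x) \<in> AP conv" "(\<lambda>x. b * g x) \<in> AP conv"
    using AP_combination[OF assms(2,3), of a 0] AP_combination[OF assms(2,3), of 0 b] by simp_all
  then show ?thesis using assms by (simp add: dual_space_def)
qed

lemma dual_sum:
  assumes \<mu>: "\<mu> \<in> dual_space (AP conv)" and "finite T" and F: "\<And>t. F t \<in> AP conv"
  shows "(\<lambda>x. \<Sum>t\<in>T. c t * F t x) \<in> AP conv \<and> \<mu> (\<lambda>x. \<Sum>t\<in>T. c t * F t x) = (\<Sum>t\<in>T. c t * \<mu> (F t))"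
  using assms(2)
proof (induction T rule: finite_induct)
  case empty
  show ?case using dual_combination[OF \<mu> AP_zero AP_zero, of 0 0] AP_zero by simp
next
  case (insert t T)
  then show ?case
    using AP_combination[OF F[of t] conjunct1[OF insert(3)], of "c t" 1]
      dual_combination[OF \<mu> F[of t] conjunct1[OF insert(3)], of "c t" 1]
    by simp
qed

text \<open>
  The bound of \<open>\<mu>\<close> in terms of pointwise differences, which avoids the norm on the type of
  bounded continuous functions.
\<close>

lemma dual_lipschitz:
  assumes \<mu>: "\<mu> \<in> dual_space (AP conv)"
  obtains B where "B \<ge> 0" "\<forall>f\<in>AP conv. \<forall>g\<in>AP conv. \<forall>d. (\<forall>x. cmod (f x - g x) \<le> d) \<longrightarrow> cmod (\<mu> f - \<mu> g) \<le> B * d"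
proof -
  have "\<exists>B. \<forall>f\<in>AP conv. cmod (\<mu> f) \<le> B * norm (Bcontfun f)"
    using \<mu> unfolding dual_space_def by blast
  then obtain B where B: "\<forall>f\<in>AP conv. cmod (\<mu> f) \<le> B * norm (Bcontfun f)" by blast
  have "cmod (\<mu> f - \<mu> g) \<le> \<bar>B\<bar> * d" if f: "f \<in> AP conv" and g: "g \<in> AP conv" and d: "\<And>x. cmod (f x - g x) \<le> d" for f g d
  proof -
    let ?h = "\<lambda>x. 1 * f x + (- 1) * g x"
    have h: "?h \<in> AP conv" by (rule AP_combination[OF f g])
    have "\<mu> f - \<mu> g = \<mu> ?h" using dual_combination[OF \<mu> f g, of 1 "- 1"] by simp
    also have "cmod \<dots> \<le> B * norm (Bcontfun ?h)" by (rule bspec[OF B h])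
    also have "\<dots> \<le> \<bar>B\<bar> * norm (Bcontfun ?h)" by (intro mult_right_mono) auto
    also have "\<dots> \<le> \<bar>B\<bar> * d"
    proof (intro mult_left_mono norm_bound)
      show "cmod (apply_bcontfun (Bcontfun ?h) x) \<le> d" for x
        unfolding Bcontfun_inverse[OF AP_bcontfun[OF h]] using d[of x] by simp
    qed simp
    finally show ?thesis .
  qed
  then show thesis using that[of "\<bar>B\<bar>"] by simp
qed

text \<open>
  Continuity holds because \<open>t \<mapsto> L\<^sub>t f\<close> is continuous in supremum norm: up to a small error, the distance
  of \<open>L\<^sub>s f\<close> and \<open>L\<^sub>t f\<close> is measured at a finite net of points \<open>y\<close>, and each \<open>R\<^sub>y f\<close> is
  continuous.
\<close>

lemma T_op_bcontfun:
  assumes \<mu>: "\<mu> \<in> dual_space (AP conv)" and f: "f \<in> AP conv"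
  shows "T_op conv \<mu> f \<in> bcontfun"
proof -
  obtain B where B: "B \<ge> 0"
    "\<forall>f\<in>AP conv. \<forall>g\<in>AP conv. \<forall>d. (\<forall>x. cmod (f x - g x) \<le> d) \<longrightarrow> cmod (\<mu> f - \<mu> g) \<le> B * d"
    by (rule dual_lipschitz[OF \<mu>])
  have bf: "f \<in> bcontfun" and tb: "totally_bounded_family (range (\<lambda>z. Rtrans conv z f))"
    using f by (simp_all add: AP_iff_Rtrans)
  obtain D where D: "\<And>x. cmod (f x) \<le> D" using bcontfunD(2)[OF bf] by (auto simp: bounded_iff)
  show ?thesis
  proof (rule bcontfun_normI)
    have "\<mu> (\<lambda>x. 0) = 0" using dual_combination[OF \<mu> AP_zero AP_zero, of 0 0] by simp
    then show "cmod (T_op conv \<mu> f t) \<le> B * D" for t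
      using B(2)[rule_format, OF AP_Ltrans[OF f] AP_zero, of t D] Ltrans_bound[OF bf D] by (simp add: T_op_def)
    show "continuous_on UNIV (T_op conv \<mu> f)"
      unfolding continuous_on_def
    proof (intro ballI tendstoI)
      fix t and e :: real assume "e > 0"
      \<comment> \<open>The distance of \<open>L\<^sub>s f\<close> and \<open>L\<^sub>t f\<close> will be at most \<open>3 * d\<close>.\<close>
      define d where "d = e / (3 * B + 1)"
      have d: "d > 0" "B * (3 * d) < e" using B(1) \<open>e > 0\<close> by (simp_all add: d_def field_simps)
      obtain Y where Y: "finite Y" "\<And>z. \<exists>y\<in>Y. \<forall>x. cmod (Rtrans conv z f x - Rtrans conv y f x) \<le> d"
        by (rule totally_bounded_familyE[OF tb d(1)]) (rule that)
      have "\<forall>\<^sub>F s in at t. \<forall>y\<in>Y. dist (Rtrans conv y f s) (Rtrans conv y f t) < d"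
        using Y(1) d(1) bcontfunD(3)[OF Rtrans_bcontfun[OF bf]]
        by (intro eventually_ball_finite ballI tendstoD) (auto simp: continuous_on_def)
      then show "\<forall>\<^sub>F s in at t within UNIV. dist (T_op conv \<mu> f s) (T_op conv \<mu> f t) < e"
      proof eventually_elim
        case (elim s)
        have "cmod (Ltrans conv s f z - Ltrans conv t f z) \<le> 3 * d" for z
        proof -
          obtain y where y: "y \<in> Y" "\<And>x. cmod (Rtrans conv z f x - Rtrans conv y f x) \<le> d" using Y(2) by blast
          have "Ltrans conv s f z - Ltrans conv t f z = (Rtrans conv z f s - Rtrans conv y f s)
             + (Rtrans conv y f s - Rtrans conv y f t) - (Rtrans conv z f t - Rtrans conv y f t)"
            by (simp add: Ltrans_eq_Rtrans)
          also have "cmod \<dots> \<le> (d + d) + d"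
            using elim y(1)
            by (intro order_trans[OF norm_triangle_ineq4 add_mono] order_trans[OF norm_triangle_ineq add_mono] y(2))
              (auto simp: dist_norm intro: less_imp_le)
          finally show ?thesis by simp
        qed
        from B(2)[rule_format, OF AP_Ltrans[OF f] AP_Ltrans[OF f] this] d(2)
        show ?case by (simp add: T_op_def dist_norm)
      qed
    qed
  qed
qed

text \<open>
  Sampling \<open>\<nu>\<close> by a finitely supported measure \<open>\<Sum>t\<in>T. c t p\<^sub>t\<close> makes \<open>\<Sum>t\<in>T. c t L\<^sub>t f\<close> close to \<open>h\<close> at the points of
  a finite net \<open>Y\<close>, where \<open>h\<close> is the average of the \<open>L\<^sub>t f\<close> over \<open>\<nu>\<close>. Total boundedness of the right
  translates extends this to all points, so the functional \<open>\<mu>\<close>, which need not be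
  continuous for pointwise convergence, can be applied.
\<close>

lemma dual_integral_interchange:
  assumes \<mu>: "\<mu> \<in> dual_space (AP conv)" and f: "f \<in> AP conv" and \<nu>: "\<nu> \<in> pos_measures"
    and h: "(\<lambda>z. integral\<^sup>L (to_measure \<nu>) (Rtrans conv z f)) \<in> AP conv"
  shows "\<mu> (\<lambda>z. integral\<^sup>L (to_measure \<nu>) (Rtrans conv z f)) = integral\<^sup>L (to_measure \<nu>) (T_op conv \<mu> f)"
    (is "\<mu> ?h = ?r")
proof -
  obtain B where B: "B \<ge> 0"
    "\<forall>f\<in>AP conv. \<forall>g\<in>AP conv. \<forall>d. (\<forall>x. cmod (f x - g x) \<le> d) \<longrightarrow> cmod (\<mu> f - \<mu> g) \<le> B * d"
    by (rule dual_lipschitz[OF \<mu>])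
  have bf: "f \<in> bcontfun" and tb: "totally_bounded_family (range (\<lambda>z. Rtrans conv z f))"
    using f by (simp_all add: AP_iff_Rtrans)
  have nn: "nonneg_borel_measure \<nu>" by (rule pos_nonneg[OF \<nu>])
  define m where "m = Re (\<nu> UNIV)"
  have m: "m \<ge> 0" using nn by (simp add: m_def nonneg_borel_measure_def)
  have main: "cmod (\<mu> ?h - ?r) \<le> B * (d * (2 * m + 1 + d)) + d" if d: "d > 0" for d
  proof -
    obtain Y where Y: "finite Y" "\<And>z. \<exists>y\<in>Y. \<forall>x. cmod (Rtrans conv z f x - Rtrans conv y f x) \<le> d"
      by (rule totally_bounded_familyE[OF tb d]) (rule that)
    \<comment> \<open>Sampling the constant function controls the total weight of the sample; sampling \<open>T\<^sub>\<mu> f\<close> itself gives the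
      right-hand side of the claim.\<close>
    define F where "F = insert (\<lambda>x. 1) (insert (T_op conv \<mu> f) ((\<lambda>y. Rtrans conv y f) ` Y))"
    have "F \<subseteq> bcontfun"
      using T_op_bcontfun[OF \<mu> f] Rtrans_bcontfun[OF bf] const_bcontfun[of 1] by (auto simp: F_def)
    then have F: "finite F" "F \<subseteq> borel_measurable borel" "\<forall>h\<in>F. bounded (range h)"
      using bcontfunD Y(1) by (auto simp: F_def)
    obtain T c where T: "finite T" "\<And>t. t \<in> T \<Longrightarrow> c t \<ge> 0"
      and app: "\<And>h. h \<in> F \<Longrightarrow> cmod (integral\<^sup>L (to_measure \<nu>) h - (\<Sum>t\<in>T. complex_of_real (c t) * h t)) \<le> d"
      by (rule discrete_approximation[OF nn F d]) (rule that)
    let ?s = "\<lambda>z. \<Sum>t\<in>T. complex_of_real (c t) * Ltrans conv t f z"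
    have s: "?s \<in> AP conv" "\<mu> ?s = (\<Sum>t\<in>T. complex_of_real (c t) * T_op conv \<mu> f t)"
      using dual_sum[OF \<mu> T(1), of "\<lambda>t. Ltrans conv t f" "\<lambda>t. complex_of_real (c t)"] AP_Ltrans[OF f] by (simp_all add: T_op_def)
    have "cmod (complex_of_real (m - (\<Sum>t\<in>T. c t))) \<le> d"
      using app[of "\<lambda>x. 1"] by (simp add: F_def m_def measure_to_measure[OF nn] scaleR_conv_of_real)
    then have mass: "(\<Sum>t\<in>T. c t) \<le> m + d" unfolding norm_of_real by linarith
    have "cmod (?h z - ?s z) \<le> d * (2 * m + 1 + d)" for z
    proof -
      obtain y where y: "y \<in> Y" "\<And>x. cmod (Rtrans conv z f x - Rtrans conv y f x) \<le> d" using Y(2) by blast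
      let ?I = "integral\<^sup>L (to_measure \<nu>)"
      have "?h z - ?s z = (?I (Rtrans conv z f) - ?I (Rtrans conv y f))
         + (?I (Rtrans conv y f) - (\<Sum>t\<in>T. complex_of_real (c t) * Rtrans conv y f t))
         - (\<Sum>t\<in>T. complex_of_real (c t) * (Rtrans conv z f t - Rtrans conv y f t))"
        by (simp add: Ltrans_eq_Rtrans right_diff_distrib sum_subtractf)
      also have "cmod \<dots> \<le> (d * m + d) + (\<Sum>t\<in>T. c t * d)"
      proof (rule order_trans[OF norm_triangle_ineq4 add_mono[OF order_trans[OF norm_triangle_ineq add_mono] sum_norm_le]])
        show "cmod (?I (Rtrans conv z f) - ?I (Rtrans conv y f)) \<le> d * m"
          unfolding m_def by (intro integral_diff_le nn Rtrans_bcontfun bf y(2))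
        show "cmod (?I (Rtrans conv y f) - (\<Sum>t\<in>T. complex_of_real (c t) * Rtrans conv y f t)) \<le> d"
          using y(1) by (intro app) (simp add: F_def)
        show "cmod (complex_of_real (c t) * (Rtrans conv z f t - Rtrans conv y f t)) \<le> c t * d" if "t \<in> T" for t
          using T(2)[OF that] y(2)[of t] by (simp add: norm_mult mult_left_mono)
      qed
      also have "(\<Sum>t\<in>T. c t * d) = d * (\<Sum>t\<in>T. c t)" by (simp add: sum_distrib_left mult.commute)
      also have "(d * m + d) + d * (\<Sum>t\<in>T. c t) \<le> (d * m + d) + d * (m + d)"
        using mass d by (intro add_left_mono mult_left_mono) auto
      also have "\<dots> = d * (2 * m + 1 + d)" by (simp add: algebra_simps)
      finally show ?thesis .
    qed
    then have 1: "cmod (\<mu> ?h - \<mu> ?s) \<le> B * (d * (2 * m + 1 + d))" by (rule B(2)[rule_format, OF h s(1)])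
    have 2: "cmod (?r - \<mu> ?s) \<le> d" unfolding s(2) by (rule app) (simp add: F_def)
    have "cmod (\<mu> ?h - ?r) = cmod ((\<mu> ?h - \<mu> ?s) - (?r - \<mu> ?s))" by simp
    also have "\<dots> \<le> B * (d * (2 * m + 1 + d)) + d"
      by (rule order_trans[OF norm_triangle_ineq4 add_mono[OF 1 2]])
    finally show ?thesis .
  qed
  have "((\<lambda>d. B * (d * (2 * m + 1 + d)) + d) \<longlongrightarrow> B * (0 * (2 * m + 1 + 0)) + 0) (at_right 0)"
    by (intro tendsto_intros)
  then have "cmod (\<mu> ?h - ?r) \<le> B * (0 * (2 * m + 1 + 0)) + 0"
  proof (rule tendsto_lowerbound)
    show "\<forall>\<^sub>F d in at_right 0. cmod (\<mu> ?h - ?r) \<le> B * (d * (2 * m + 1 + d)) + d"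
      using eventually_at_right_less[of 0] by eventually_elim (rule main)
  qed simp
  then show ?thesis by simp
qed

text \<open>
  Both sides at \<open>y\<close> apply \<open>\<mu>\<close> to the average of the \<open>L\<^sub>t f\<close> over \<open>t\<close> distributed as \<open>x * y\<close>.
\<close>

lemma Ltrans_T_op:
  assumes \<mu>: "\<mu> \<in> dual_space (AP conv)" and f: "f \<in> AP conv"
  shows "Ltrans conv x (T_op conv \<mu> f) = T_op conv \<mu> (Ltrans conv x f)"
proof
  fix y
  let ?\<nu> = "point_mass x \<star> point_mass y"
  have eq: "(\<lambda>z. integral\<^sup>L (to_measure ?\<nu>) (Rtrans conv z f)) = Ltrans conv y (Ltrans conv x f)"
    using Ltrans_Ltrans[OF AP_bcontfun[OF f]] by auto
  have "Ltrans conv x (T_op conv \<mu> f) y = integral\<^sup>L (to_measure ?\<nu>) (T_op conv \<mu> f)"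
    by (simp add: Ltrans_def)
  also have "\<dots> = \<mu> (Ltrans conv y (Ltrans conv x f))"
    using dual_integral_interchange[OF \<mu> f point_conv_pos[of x y]] AP_Ltrans[OF AP_Ltrans[OF f]] unfolding eq by simp
  also have "\<dots> = T_op conv \<mu> (Ltrans conv x f) y" by (simp add: T_op_def)
  finally show "Ltrans conv x (T_op conv \<mu> f) y = T_op conv \<mu> (Ltrans conv x f) y" .
qed

text \<open>
  The left translates \<open>L\<^sub>x T\<^sub>\<mu> f = T\<^sub>\<mu> L\<^sub>x f\<close> form the image of the \<open>L\<^sub>x f\<close> under a Lipschitz map.
\<close>

lemma T_op_AP:
  assumes \<mu>: "\<mu> \<in> dual_space (AP conv)" and f: "f \<in> AP conv"
  shows "T_op conv \<mu> f \<in> AP conv"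
proof -
  obtain B where B: "B \<ge> 0"
    "\<forall>f\<in>AP conv. \<forall>g\<in>AP conv. \<forall>d. (\<forall>x. cmod (f x - g x) \<le> d) \<longrightarrow> cmod (\<mu> f - \<mu> g) \<le> B * d"
    by (rule dual_lipschitz[OF \<mu>])
  have tb: "totally_bounded_family (range (\<lambda>x. Ltrans conv x f))" using f by (simp add: AP_iff_Ltrans)
  have "totally_bounded_family (range (\<lambda>x. T_op conv \<mu> (Ltrans conv x f)))"
  proof (rule totally_bounded_family_image[OF tb, of _ B])
    fix x x' d y
    assume d: "\<And>z. cmod (Ltrans conv x f z - Ltrans conv x' f z) \<le> d"
    have "Ltrans conv w f \<in> bcontfun" for w by (rule AP_bcontfun[OF AP_Ltrans[OF f]])
    from Ltrans_diff_le[OF this this d]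
    show "cmod (T_op conv \<mu> (Ltrans conv x f) y - T_op conv \<mu> (Ltrans conv x' f) y) \<le> B * d"
      unfolding T_op_def by (intro B(2)[rule_format] AP_Ltrans f)
  qed
  then show ?thesis
    unfolding AP_iff_Ltrans using T_op_bcontfun[OF \<mu> f] by (simp add: Ltrans_T_op[OF \<mu> f])
qed

end

theorem corollary4p18:
  fixes conv :: "('a::t2_space set \<Rightarrow> complex) \<Rightarrow> ('a set \<Rightarrow> complex) \<Rightarrow> ('a set \<Rightarrow> complex)"
  assumes "semitopological_semihypergroup conv"
  shows "\<forall>\<mu> \<in> dual_space (AP conv). \<forall>f \<in> AP conv.
           T_op conv \<mu> f \<in> AP conv \<and> U_op conv \<mu> f \<in> AP conv"
proof -
  interpret semitopological_semihypergroup conv by (rule assms)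
  show ?thesis
    using T_op_AP semitopological_semihypergroup.T_op_AP[OF opposite, unfolded opposite_simps] by blast
qed

end
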